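(* Let $n\ge 1$ and let $\{W,V_1,\dots,V_n\}$ be an isometric representation of the odometer semigroup $\mathbb{O}_n$ on a Hilbert space $\mathcal{H}$. Then $\mathcal{H}$ decomposes uniquely as an orthogonal direct sum $$\mathcal{H}=\mathcal{H}_{uu}\oplus\mathcal{H}_{us}\oplus\mathcal{H}_{su}\oplus\mathcal{H}_{ws}$$ such that: (1) the subspaces $\mathcal{H}_{uu},\mathcal{H}_{us},\mathcal{H}_{su},\mathcal{H}_{ws}$ are reducing for $W$ and for every $V_i$; (2) $W|_{\mathcal{H}_{uu}}$ is unitary and $\{V_1,\dots,V_n\}|_{\mathcal{H}_{uu}}$ is a row unitary; (3) $W|_{\mathcal{H}_{us}}$ is unitary and $\{V_1,\dots,V_n\}|_{\mathcal{H}_{us}}$ is a pure row isometry; (4) $W|_{\mathcal{H}_{su}}$ is a pure isometry and $\{V_1,\dots,V_n\}|_{\mathcal{H}_{su}}$ is a row unitary; (5) the family $\{W|_{\mathcal{H}_{ws}},V_1|_{\mathcal{H}_{ws}},\dots,V_n|_{\mathcal{H}_{ws}}\}$ is a weak bi-shift.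
   Context: A (closed) subspace reduces an operator $T$ if it is invariant for $T$ and $T^*$. An isometry $V$ on $\mathcal{H}$ is pure if $\bigcap_{m\ge 0}V^m\mathcal{H}=\{0\}$ (equivalently, it is a direct sum of unilateral shifts). A row isometry is a family $\{V_1,\dots,V_n\}$ of isometries on $\mathcal{H}$ with pairwise orthogonal ranges, i.e. $\sum_{k}V_kV_k^*\le I$; it is a row unitary if $\sum_k V_kV_k^*=I$. $\mathbb{F}_n^+$ is the free semigroup (with empty word) on $\{1,\dots,n\}$, and for $\mu=\mu_1\cdots\mu_m\in\mathbb{F}_n^+$, $V_\mu=V_{\mu_1}\cdots V_{\mu_m}$, $|\mu|=m$. A row isometry is pure if $\bigcap_{m\ge 0}\bigoplus_{|\mu|=m}V_\mu\mathcal{H}=\{0\}$ (equivalently, it is a direct sum of copies of the left regular representation of $\mathbb{F}_n^+$). Summands in a decomposition may be $\{0\}$. An isometric representation of the odometer semigroup $\mathbb{O}_n$ on $\mathcal{H}$ is a collection $\{W,V_1,\dots,V_n\}$ consisting of an isometry $W$ and a row isometry $\{V_1,\dots,V_n\}$ on $\mathcal{H}$ such that $WV_k=V_{k+1}$ for $1\le k\le n-1$ and $WV_n=V_1W$. An isometric representation $\{W,V_1,\dots,V_n\}$ is a weak bi-shift if the operators $W|_{\bigcap_{i=1}^n\bigcap_{j\ge 0}\ker V_i^*W^j}$ and $V_1|_{\bigcap_{j\ge 0}\ker W^*V_1^j}$ (restrictions to invariant subspaces of $W$ and $V_1$ respectively) are pure isometries and the family $\{V_2,\dots,V_n,V_1W\}$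 is a pure row isometry. *)

theory Defs
  imports "HOL-Analysis.Analysis"
begin

class complex_vector = real_vector +
  fixes scaleC :: "complex \<Rightarrow> 'a \<Rightarrow> 'a"  (infixr "*\<^sub>C" 75)
  assumes scaleC_add_right: "a *\<^sub>C (x + y) = a *\<^sub>C x + a *\<^sub>C y"
    and scaleC_add_left: "(a + b) *\<^sub>C x = a *\<^sub>C x + b *\<^sub>C x"
    and scaleC_scaleC: "a *\<^sub>C b *\<^sub>C x = (a * b) *\<^sub>C x"
    and scaleC_of_real: "complex_of_real r *\<^sub>C x = r *\<^sub>R x"

global_interpretation complex_vector:
  vector_space "scaleC :: complex \<Rightarrow> 'a \<Rightarrow> 'a :: complex_vector"
proof
  show "1 *\<^sub>C x = x" for x :: 'a
    using scaleC_of_real[of 1 x] by simp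
qed (rule scaleC_add_right scaleC_add_left scaleC_scaleC)+

(* Complex Hilbert spaces, of arbitrary dimension. The inner product is linear in its first
   argument; that it is positive definite is part of the last axiom, since norm x = 0 only
   for x = 0. *)
class complex_hilbert_space = complex_vector + banach +
  fixes cinner :: "'a \<Rightarrow> 'a \<Rightarrow> complex"
  assumes cinner_commute: "cinner x y = cnj (cinner y x)"
    and cinner_add_left: "cinner (x + y) z = cinner x z + cinner y z"
    and cinner_scaleC_left: "cinner (a *\<^sub>C x) y = a * cinner x y"
    and cinner_self: "cinner x x = complex_of_real ((norm x)\<^sup>2)"

instantiation complex :: complex_hilbert_space
begin

definition scaleC_complex :: "complex \<Rightarrow> complex \<Rightarrow> complex" where
  "scaleC_complex a x = a * x"

definition cinner_complex :: "complex \<Rightarrow> complex \<Rightarrow> complex" where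
  "cinner_complex x y = x * cnj y"

instance
proof
  fix a b x y z :: complex and r :: real
  show "a *\<^sub>C (x + y) = a *\<^sub>C x + a *\<^sub>C y"
    unfolding scaleC_complex_def by (rule distrib_left)
  show "(a + b) *\<^sub>C x = a *\<^sub>C x + b *\<^sub>C x"
    unfolding scaleC_complex_def by (rule distrib_right)
  show "a *\<^sub>C b *\<^sub>C x = (a * b) *\<^sub>C x"
    unfolding scaleC_complex_def by (rule mult.assoc[symmetric])
  show "complex_of_real r *\<^sub>C x = r *\<^sub>R x"
    unfolding scaleC_complex_def by (rule scaleR_conv_of_real[symmetric])
  show "cinner x y = cnj (cinner y x)"
    unfolding cinner_complex_def by simp
  show "cinner (x + y) z = cinner x z + cinner y z"
    unfolding cinner_complex_def by (rule distrib_right)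
  show "cinner (a *\<^sub>C x) y = a * cinner x y"
    unfolding cinner_complex_def scaleC_complex_def by (rule mult.assoc)
  show "cinner x x = complex_of_real ((norm x)\<^sup>2)"
    unfolding cinner_complex_def by (rule complex_norm_square[symmetric])
qed

end

definition closed_csubspace :: "'a::complex_hilbert_space set \<Rightarrow> bool" where
  "closed_csubspace M \<longleftrightarrow> complex_vector.subspace M \<and> closed M"

definition orthogonal_sets ::
    "'a::complex_hilbert_space set \<Rightarrow> 'a set \<Rightarrow> bool" where
  "orthogonal_sets M N \<longleftrightarrow> (\<forall>x\<in>M. \<forall>y\<in>N. cinner x y = 0)"

(* All notions for operators are relative to a closed subspace M, regarded as a Hilbert space
   in its own right: a predicate on M says something about the restriction T|M, and the values
   of T outside M are irrelevant. *)

definition operator_on :: "'a::complex_hilbert_space set \<Rightarrow> ('a \<Rightarrow> 'a) \<Rightarrow> bool" where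
  "operator_on M T \<longleftrightarrow> T ` M \<subseteq> M \<and>
     (\<forall>x\<in>M. \<forall>y\<in>M. T (x + y) = T x + T y) \<and>
     (\<forall>a. \<forall>x\<in>M. T (a *\<^sub>C x) = a *\<^sub>C T x)"

(* The adjoint of T|M as an operator on M. *)
definition adjoint_on ::
    "'a::complex_hilbert_space set \<Rightarrow> ('a \<Rightarrow> 'a) \<Rightarrow> 'a \<Rightarrow> 'a" where
  "adjoint_on M T y = (THE z. z \<in> M \<and> (\<forall>x\<in>M. cinner (T x) y = cinner x z))"

definition reduces :: "'a::complex_hilbert_space set \<Rightarrow> ('a \<Rightarrow> 'a) \<Rightarrow> bool" where
  "reduces M T \<longleftrightarrow>
     closed_csubspace M \<and> T ` M \<subseteq> M \<and> adjoint_on UNIV T ` M \<subseteq> M"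

definition isometry_on :: "'a::complex_hilbert_space set \<Rightarrow> ('a \<Rightarrow> 'a) \<Rightarrow> bool" where
  "isometry_on M T \<longleftrightarrow> operator_on M T \<and> (\<forall>x\<in>M. norm (T x) = norm x)"

definition unitary_on :: "'a::complex_hilbert_space set \<Rightarrow> ('a \<Rightarrow> 'a) \<Rightarrow> bool" where
  "unitary_on M T \<longleftrightarrow> isometry_on M T \<and>
     (\<forall>x\<in>M. adjoint_on M T (T x) = x \<and> T (adjoint_on M T x) = x)"

definition pure_isometry_on ::
    "'a::complex_hilbert_space set \<Rightarrow> ('a \<Rightarrow> 'a) \<Rightarrow> bool" where
  "pure_isometry_on M T \<longleftrightarrow> isometry_on M T \<and> (\<Inter>m. (T ^^ m) ` M) = {0}"

(* A family of n operators is a function V on the natural numbers of which only the values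
   V 1, ..., V n matter. *)

definition row_isometry_on ::
    "'a::complex_hilbert_space set \<Rightarrow> nat \<Rightarrow> (nat \<Rightarrow> 'a \<Rightarrow> 'a) \<Rightarrow> bool" where
  "row_isometry_on M n V \<longleftrightarrow>
     (\<forall>i\<in>{1..n}. isometry_on M (V i)) \<and>
     (\<forall>i\<in>{1..n}. \<forall>j\<in>{1..n}. i \<noteq> j \<longrightarrow> orthogonal_sets (V i ` M) (V j ` M))"

definition row_unitary_on ::
    "'a::complex_hilbert_space set \<Rightarrow> nat \<Rightarrow> (nat \<Rightarrow> 'a \<Rightarrow> 'a) \<Rightarrow> bool" where
  "row_unitary_on M n V \<longleftrightarrow> row_isometry_on M n V \<and>
     (\<forall>x\<in>M. (\<Sum>k=1..n. V k (adjoint_on M (V k) x)) = x)"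

(* The words of length m in the free semigroup on {1..n}. *)
definition words :: "nat \<Rightarrow> nat \<Rightarrow> nat list set" where
  "words n m = {\<mu>. length \<mu> = m \<and> set \<mu> \<subseteq> {1..n}}"

(* The sum of the subspaces V_\<mu> M over the words \<mu> of length m; note that
   foldr V [i, j, ...] = V i \<circ> V j \<circ> ... is the operator V_\<mu>. *)
definition word_range ::
    "'a::complex_hilbert_space set \<Rightarrow> nat \<Rightarrow> (nat \<Rightarrow> 'a \<Rightarrow> 'a) \<Rightarrow> nat \<Rightarrow> 'a set" where
  "word_range M n V m =
     {\<Sum>\<mu>\<in>words n m. foldr V \<mu> (h \<mu>) | h. \<forall>\<mu>\<in>words n m. h \<mu> \<in> M}"

definition pure_row_isometry_on ::
    "'a::complex_hilbert_space set \<Rightarrow> nat \<Rightarrow> (nat \<Rightarrow> 'a \<Rightarrow> 'a) \<Rightarrow> bool" where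
  "pure_row_isometry_on M n V \<longleftrightarrow>
     row_isometry_on M n V \<and> (\<Inter>m. word_range M n V m) = {0}"

definition odometer_rep_on ::
    "'a::complex_hilbert_space set \<Rightarrow> nat \<Rightarrow> ('a \<Rightarrow> 'a) \<Rightarrow> (nat \<Rightarrow> 'a \<Rightarrow> 'a) \<Rightarrow> bool" where
  "odometer_rep_on M n W V \<longleftrightarrow>
     isometry_on M W \<and> row_isometry_on M n V \<and>
     (\<forall>k\<in>{1..<n}. \<forall>x\<in>M. W (V k x) = V (k + 1) x) \<and>
     (\<forall>x\<in>M. W (V n x) = V 1 (W x))"

(* In the last conjunct the family V 2, ..., V n, V 1 \<circ> W is numbered from 1 to n. *)
definition weak_bishift_on ::
    "'a::complex_hilbert_space set \<Rightarrow> nat \<Rightarrow> ('a \<Rightarrow> 'a) \<Rightarrow> (nat \<Rightarrow> 'a \<Rightarrow> 'a) \<Rightarrow> bool" where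
  "weak_bishift_on M n W V \<longleftrightarrow>
     odometer_rep_on M n W V \<and>
     pure_isometry_on
       {x\<in>M. \<forall>i\<in>{1..n}. \<forall>j. adjoint_on M (V i) ((W ^^ j) x) = 0} W \<and>
     pure_isometry_on {x\<in>M. \<forall>j. adjoint_on M W ((V 1 ^^ j) x) = 0} (V 1) \<and>
     pure_row_isometry_on M n (\<lambda>k. if k < n then V (k + 1) else V 1 \<circ> W)"

end

theory Submission
  imports Defs
begin

text \<open>
  Let \<open>KW\<close> (\<open>KV\<close>) be the largest jointly reducing subspace on which \<open>W\<close> is unitary (the \<open>V k\<close> form
  a row unitary). Then necessarily \<open>Huu = KW \<inter> KV\<close>, \<open>Hus = KW \<ominus> Huu\<close>, \<open>Hsu = KV \<ominus> Huu\<close> and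
  \<open>Hws\<close> is the orthogonal complement of \<open>KW + KV\<close>. Existence amounts to purity: an intersection
  of word ranges or of ranges of powers that fails to vanish is, or generates, a jointly reducing
  subspace on which \<open>W\<close> or \<open>V\<close> is unitary, hence is contained in \<open>KW\<close> or \<open>KV\<close>.
  For uniqueness, a reducing subspace on which \<open>W\<close> is unitary is orthogonal to any reducing
  subspace on which \<open>W\<close> is pure (likewise for \<open>V\<close>), and a weak bi-shift contains no nonzero
  reducing subspace on which \<open>W\<close> or \<open>V\<close> is unitary.
\<close>

subsection \<open>Complex Hilbert spaces\<close>

text \<open>The relations determine \<open>adj W (V k x)\<close> and \<open>adj (V k) (W x)\<close>
  for k > 1 but leave both undetermined for k = 1. Hence \<open>W\<close> and the row need not
  doubly commute, and the intersected ranges of powers of \<open>W\<close>, or of words in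
  \<open>V\<close>, need not reduce the other operators. Two remedies shape the proof. Where
  \<open>W\<close> is unitary, W V_n = V_1 W can be read backwards; where \<open>V\<close> is a row
  unitary, every vector can be expanded along the row. So purity on \<open>Hus\<close> and
  \<open>Hsu\<close> is tested inside spaces on which the other constituent is already unitary. On a
  general reducing space the family W V_1, ..., W V_n of the third weak bi-shift condition takes
  over: its iterated ranges intersect in a reducing space, since \<open>adj W\<close> turns W V_k
  back into V_k. The three purity conditions of a weak bi-shift exclude, in their order, summands of
  type us, su and uu: the defect spaces catch the wandering vectors of a summand with one unitary
  constituent, and if there are none, the other constituent is unitary as well.\<close>

lemma cinner_add_right: "cinner x (y + z) = cinner x y + cinner x z"
  by (metis cinner_add_left cinner_commute complex_cnj_add)

lemma cinner_scaleC_right: "cinner x (a *\<^sub>C y) = cnj a * cinner x y"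
  by (metis cinner_scaleC_left cinner_commute complex_cnj_mult)

lemma scaleC_minus_one: "(- 1) *\<^sub>C x = - x" for x :: "'a::complex_vector"
  by simp

lemma cinner_minus_left: "cinner (- x) y = - cinner x y"
  by (metis cinner_scaleC_left scaleC_minus_one mult_minus1)

lemma cinner_minus_right: "cinner x (- y) = - cinner x y"
  by (metis cinner_commute cinner_minus_left complex_cnj_minus)

lemma cinner_diff_left: "cinner (x - y) z = cinner x z - cinner y z"
  using cinner_add_left[of x "- y" z] by (simp add: cinner_minus_left)

lemma cinner_diff_right: "cinner x (y - z) = cinner x y - cinner x z"
  using cinner_add_right[of x y "- z"] by (simp add: cinner_minus_right)

lemma cinner_zero_left [simp]: "cinner 0 x = 0"
  using cinner_diff_left[of x x x] by simp

lemma cinner_zero_right [simp]: "cinner x 0 = 0"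
  using cinner_diff_right[of x x x] by simp

lemma cinner_sum_right: "cinner x (\<Sum>i\<in>I. f i) = (\<Sum>i\<in>I. cinner x (f i))"
  by (induction I rule: infinite_finite_induct) (auto simp: cinner_add_right)

lemma cinner_self_eq_0_iff [simp]: "cinner x x = 0 \<longleftrightarrow> x = 0"
  by (simp add: cinner_self)

lemma cinner_eq_0_commute: "cinner x y = 0 \<longleftrightarrow> cinner y x = 0"
  by (metis cinner_commute complex_cnj_zero)

lemma norm_add_square:
  "(norm (x + y))\<^sup>2 = (norm x)\<^sup>2 + (norm y)\<^sup>2 + 2 * Re (cinner x y)"
  for x y :: "'a::complex_hilbert_space"
proof -
  have "complex_of_real ((norm (x + y))\<^sup>2)
      = complex_of_real ((norm x)\<^sup>2) + complex_of_real ((norm y)\<^sup>2) + (cinner x y + cnj (cinner x y))"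
    by (simp add: cinner_self[symmetric] cinner_add_left cinner_add_right cinner_commute[of y x]
        del: of_real_power)
  also have "\<dots> = complex_of_real ((norm x)\<^sup>2 + (norm y)\<^sup>2 + 2 * Re (cinner x y))"
    by (simp add: complex_add_cnj)
  finally show ?thesis by (simp only: of_real_eq_iff)
qed

lemma norm_diff_square:
  "(norm (x - y))\<^sup>2 = (norm x)\<^sup>2 + (norm y)\<^sup>2 - 2 * Re (cinner x y)"
  for x y :: "'a::complex_hilbert_space"
  using norm_add_square[of x "- y"] by (simp add: cinner_minus_right)

text \<open>The norm determines the inner product. Hence norm-preserving operators preserve it
  (\<open>isometry_cinner\<close>), and its continuity is inherited from the norm.\<close>

lemma cinner_polarization:
  "cinner x y = Complex (((norm (x + y))\<^sup>2 - (norm x)\<^sup>2 - (norm y)\<^sup>2) / 2)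
    (((norm (x + \<i> *\<^sub>C y))\<^sup>2 - (norm x)\<^sup>2 - (norm (\<i> *\<^sub>C y))\<^sup>2) / 2)"
  by (simp add: complex_eq_iff norm_add_square cinner_scaleC_right)

lemma continuous_on_cinner_left [continuous_intros]:
  assumes "continuous_on S f"
  shows "continuous_on S (\<lambda>x. cinner (f x) y)"
  unfolding cinner_polarization Complex_eq by (intro continuous_intros assms) auto

lemma closed_csubspaceI:
  assumes "0 \<in> M" "\<And>x y. x \<in> M \<Longrightarrow> y \<in> M \<Longrightarrow> x + y \<in> M"
    "\<And>a x. x \<in> M \<Longrightarrow> a *\<^sub>C x \<in> M" "closed M"
  shows "closed_csubspace M"
  using assms by (simp add: closed_csubspace_def complex_vector.subspace_def)

lemma closed_csubspace_props:
  assumes "closed_csubspace M"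
  shows closed_csubspace_0: "0 \<in> M"
    and closed_csubspace_add: "x \<in> M \<Longrightarrow> y \<in> M \<Longrightarrow> x + y \<in> M"
    and closed_csubspace_diff: "x \<in> M \<Longrightarrow> y \<in> M \<Longrightarrow> x - y \<in> M"
    and closed_csubspace_scaleC: "x \<in> M \<Longrightarrow> a *\<^sub>C x \<in> M"
    and closed_csubspace_sum: "(\<And>i. i \<in> I \<Longrightarrow> f i \<in> M) \<Longrightarrow> (\<Sum>i\<in>I. f i) \<in> M"
    and closed_csubspace_closed: "closed M"
  using assms
  by (auto simp: closed_csubspace_def complex_vector.subspace_0 complex_vector.subspace_add
      complex_vector.subspace_diff complex_vector.subspace_scale complex_vector.subspace_sum)

lemma closed_csubspace_UNIV: "closed_csubspace UNIV"
  by (simp add: closed_csubspace_def)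

lemma closed_csubspace_Inter:
  "(\<And>M. M \<in> F \<Longrightarrow> closed_csubspace M) \<Longrightarrow> closed_csubspace (\<Inter>F)"
  by (auto simp: closed_csubspace_def intro: complex_vector.subspace_Inter)

lemma closed_csubspace_Int:
  "closed_csubspace M \<Longrightarrow> closed_csubspace N \<Longrightarrow> closed_csubspace (M \<inter> N)"
  by (auto simp: closed_csubspace_def intro: complex_vector.subspace_inter)

lemma closed_csubspace_hull: "closed_csubspace (closed_csubspace hull S)"
  by (rule hull_in) (simp add: closed_csubspace_Inter)

subsection \<open>Orthogonal projections\<close>

definition orthogonal_complement :: "'a::complex_hilbert_space set \<Rightarrow> 'a set" where
  "orthogonal_complement M = {x. \<forall>y\<in>M. cinner x y = 0}"

lemma closed_csubspace_orthogonal_complement: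
  "closed_csubspace (orthogonal_complement M)"
proof (rule closed_csubspaceI)
  have "orthogonal_complement M = (\<Inter>y\<in>M. (\<lambda>x. cinner x y) -` {0})"
    by (auto simp: orthogonal_complement_def)
  moreover have "closed ((\<lambda>x. cinner x y) -` {0})" for y :: 'a
    by (intro closed_vimage continuous_intros)
  ultimately show "closed (orthogonal_complement M)" by auto
qed (auto simp: orthogonal_complement_def cinner_add_left cinner_scaleC_left)

lemma orthogonal_complement_Int: "closed_csubspace M \<Longrightarrow> x \<in> M \<Longrightarrow>
    x \<in> orthogonal_complement M \<Longrightarrow> x = 0"
  using cinner_self_eq_0_iff[of x] unfolding orthogonal_complement_def by blast

lemma orthogonal_sets_iff: "orthogonal_sets M N \<longleftrightarrow> M \<subseteq> orthogonal_complement N"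
  by (auto simp: orthogonal_sets_def orthogonal_complement_def)

lemma orthogonal_sets_commute: "orthogonal_sets M N \<longleftrightarrow> orthogonal_sets N M"
  unfolding orthogonal_sets_def by (metis cinner_eq_0_commute)

lemma parallelogram_law:
  "(norm (x + y))\<^sup>2 + (norm (x - y))\<^sup>2 = 2 * (norm x)\<^sup>2 + 2 * (norm y)\<^sup>2"
  for x y :: "'a::complex_hilbert_space"
  by (simp add: norm_add_square norm_diff_square)

text \<open>With \<open>c\<close> the coefficient of the projection of \<open>x - a\<close> onto
  \<open>y\<close>, moving from \<open>a\<close> to \<open>a + c y\<close> lowers the squared
  distance by |c|^2 |y|^2; minimality forces \<open>c = 0\<close>.\<close>

lemma nearest_point_orthogonal:
  assumes M: "closed_csubspace M" and "a \<in> M"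
    and near: "\<And>z. z \<in> M \<Longrightarrow> norm (x - a) \<le> norm (x - z)"
  shows "x - a \<in> orthogonal_complement M"
  unfolding orthogonal_complement_def
proof safe
  fix y assume "y \<in> M"
  show "cinner (x - a) y = 0"
  proof (cases "y = 0")
    case False
    define c where "c = cinner (x - a) y / complex_of_real ((norm y)\<^sup>2)"
    have "a + c *\<^sub>C y \<in> M"
      using M \<open>a \<in> M\<close> \<open>y \<in> M\<close> by (simp add: closed_csubspace_add closed_csubspace_scaleC)
    from near[OF this] have "(norm (x - a))\<^sup>2 \<le> (norm ((x - a) - c *\<^sub>C y))\<^sup>2"
      by (simp add: algebra_simps)
    moreover have "Re (cinner (x - a) (c *\<^sub>C y)) = (cmod c)\<^sup>2 * (norm y)\<^sup>2"
    proof -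
      have "cinner (x - a) y = c * complex_of_real ((norm y)\<^sup>2)"
        using False by (simp add: c_def)
      then have "cinner (x - a) (c *\<^sub>C y) = (c * cnj c) * complex_of_real ((norm y)\<^sup>2)"
        by (simp add: cinner_scaleC_right)
      then show ?thesis
        by (simp add: complex_norm_square[symmetric] del: of_real_power)
    qed
    moreover have "(norm (c *\<^sub>C y))\<^sup>2 = (cmod c)\<^sup>2 * (norm y)\<^sup>2"
    proof -
      have "complex_of_real ((norm (c *\<^sub>C y))\<^sup>2) = (c * cnj c) * complex_of_real ((norm y)\<^sup>2)"
        by (simp add: cinner_self[symmetric] cinner_scaleC_left cinner_scaleC_right
            del: of_real_power)
      also have "\<dots> = complex_of_real ((cmod c)\<^sup>2 * (norm y)\<^sup>2)"
        by (simp add: complex_norm_square[symmetric])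
      finally show ?thesis by (simp only: of_real_eq_iff)
    qed
    ultimately have "(cmod c)\<^sup>2 * (norm y)\<^sup>2 \<le> 0"
      using norm_diff_square[of "x - a" "c *\<^sub>C y"] by linarith
    then have "c = 0" using False
      by (simp add: mult_le_0_iff)
    then show ?thesis using False by (simp add: c_def)
  qed simp
qed

lemma orthogonal_decomposition:
  assumes M: "closed_csubspace M"
  obtains a where "a \<in> M" "x - a \<in> orthogonal_complement M"
proof -
  define d where "d = (INF z\<in>M. (norm (x - z))\<^sup>2)"
  have ne: "M \<noteq> {}" using M closed_csubspace_0 by blast
  have bdd: "bdd_below ((\<lambda>z. (norm (x - z))\<^sup>2) ` M)"
    by (rule bdd_belowI2[where m = 0]) simp
  have d_le: "d \<le> (norm (x - z))\<^sup>2" if "z \<in> M" for z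
    unfolding d_def by (rule cINF_lower[OF bdd that])
  have "\<exists>z\<in>M. (norm (x - z))\<^sup>2 < d + 1 / real (Suc k)" for k
    using cINF_less_iff[OF ne bdd, of "d + 1 / real (Suc k)"] by (simp add: d_def[symmetric])
  then obtain u where uM: "\<And>k. u k \<in> M"
    and u: "\<And>k. (norm (x - u k))\<^sup>2 < d + 1 / real (Suc k)"
    by metis
  have cauchy: "(norm (u k - u l))\<^sup>2 \<le> 2 / real (Suc k) + 2 / real (Suc l)" for k l
  proof -
    \<comment> \<open>The midpoint lies in \<open>M\<close>, so in the parallelogram law for the two
      residuals the sum contributes at least 4 d, which leaves a small difference.\<close>
    have "(1/2) *\<^sub>C (u k + u l) \<in> M"
      using M uM by (simp add: closed_csubspace_add closed_csubspace_scaleC)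
    then have "d \<le> (norm (x - (1/2) *\<^sub>C (u k + u l)))\<^sup>2" by (rule d_le)
    moreover have "(x - u k) + (x - u l) = 2 *\<^sub>R (x - (1/2) *\<^sub>C (u k + u l))"
    proof -
      have "(1/2) *\<^sub>C (u k + u l) = (1/2::real) *\<^sub>R (u k + u l)"
        using scaleC_of_real[of "1/2" "u k + u l"] by simp
      then show ?thesis by (simp add: algebra_simps scaleR_2)
    qed
    then have "(norm ((x - u k) + (x - u l)))\<^sup>2 = 4 * (norm (x - (1/2) *\<^sub>C (u k + u l)))\<^sup>2"
      by (simp only: norm_scaleR power_mult_distrib) simp
    moreover have "(x - u l) - (x - u k) = u k - u l" by simp
    ultimately show ?thesis
      using parallelogram_law[of "x - u l" "x - u k"] u[of k] u[of l]
      by (simp add: add.commute)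
  qed
  have "Cauchy u"
  proof (rule metric_CauchyI)
    fix e :: real assume "e > 0"
    \<comment> \<open>Both summands in \<open>cauchy\<close> are then below e^2 / 2.\<close>
    then obtain N where N: "inverse (real (Suc N)) < e\<^sup>2 / 4"
      using reals_Archimedean[of "e\<^sup>2 / 4"] by auto
    have "dist (u k) (u l) < e" if "k \<ge> N" "l \<ge> N" for k l
    proof -
      have "1 / real (Suc k) \<le> inverse (real (Suc N))" "1 / real (Suc l) \<le> inverse (real (Suc N))"
        using that by (simp_all add: field_simps)
      then have "(norm (u k - u l))\<^sup>2 < e\<^sup>2"
        using cauchy[of k l] N by simp
      then show ?thesis
        using \<open>e > 0\<close> by (metis dist_norm less_imp_le power2_less_imp_less)
    qed
    then show "\<exists>N. \<forall>k\<ge>N. \<forall>l\<ge>N. dist (u k) (u l) < e" by blast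
  qed
  then obtain a where a: "u \<longlonglongrightarrow> a"
    using Cauchy_convergent_iff convergent_def by blast
  then have aM: "a \<in> M"
    using closed_csubspace_closed[OF M] uM closed_sequentially by blast
  have "(norm (x - a))\<^sup>2 \<le> d"
  proof (rule LIMSEQ_le)
    show "(\<lambda>k. (norm (x - u k))\<^sup>2) \<longlonglongrightarrow> (norm (x - a))\<^sup>2"
      by (intro tendsto_intros a)
    show "(\<lambda>k. d + 1 / real (Suc k)) \<longlonglongrightarrow> d"
      using tendsto_add[OF tendsto_const LIMSEQ_inverse_real_of_nat, of d]
      by (simp add: inverse_eq_divide)
    show "\<exists>N. \<forall>k\<ge>N. (norm (x - u k))\<^sup>2 \<le> d + 1 / real (Suc k)"
      using u less_imp_le by blast
  qed
  then have "norm (x - a) \<le> norm (x - z)" if "z \<in> M" for z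
    using d_le[OF that] by (meson norm_ge_zero order_trans power2_le_imp_le)
  then show thesis
    using that aM nearest_point_orthogonal[OF M aM] by blast
qed

subsection \<open>Continuous operators\<close>

text \<open>Boundedness is recorded as continuity: it makes preimages and equalizers closed, which
  is what passing from generators to a closed linear span requires.\<close>

definition continuous_operator :: "('a::complex_hilbert_space \<Rightarrow> 'a) \<Rightarrow> bool" where
  "continuous_operator A \<longleftrightarrow> operator_on UNIV A \<and> continuous_on UNIV A"

lemma operator_on_UNIV_props:
  assumes "operator_on UNIV A"
  shows operator_add: "A (x + y) = A x + A y"
    and operator_scaleC: "A (a *\<^sub>C x) = a *\<^sub>C A x"
    and operator_zero: "A 0 = 0"
    and operator_diff: "A (x - y) = A x - A y"
    and operator_sum: "A (\<Sum>i\<in>I. f i) = (\<Sum>i\<in>I. A (f i))"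
proof -
  show add: "A (x + y) = A x + A y" for x y
    using assms by (simp add: operator_on_def)
  show "A (a *\<^sub>C x) = a *\<^sub>C A x"
    using assms by (simp add: operator_on_def)
  interpret additive A by unfold_locales (rule add)
  show "A 0 = 0" "A (x - y) = A x - A y" "A (\<Sum>i\<in>I. f i) = (\<Sum>i\<in>I. A (f i))"
    by (rule zero diff sum)+
qed

lemma continuous_operator_id: "continuous_operator (\<lambda>x. x)"
  by (simp add: continuous_operator_def operator_on_def)

lemma operator_on_id: "operator_on UNIV (\<lambda>x. x)"
  by (simp add: operator_on_def)

lemma continuous_operator_compose:
  assumes "continuous_operator A" "continuous_operator B"
  shows "continuous_operator (\<lambda>x. A (B x))"
  using assms
  by (auto simp: continuous_operator_def operator_on_def intro: continuous_on_compose2)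

lemma continuous_operator_sum:
  assumes "\<And>i. i \<in> I \<Longrightarrow> continuous_operator (A i)"
  shows "continuous_operator (\<lambda>x. \<Sum>i\<in>I. A i x)"
  using assms
  by (auto simp: continuous_operator_def operator_on_def sum.distrib
      complex_vector.scale_sum_right intro!: continuous_on_sum)

lemma closed_csubspace_preimage:
  assumes A: "continuous_operator A" and M: "closed_csubspace M"
  shows "closed_csubspace {x. A x \<in> M}"
proof (rule closed_csubspaceI)
  have op: "operator_on UNIV A" and cont: "continuous_on UNIV A"
    using A by (auto simp: continuous_operator_def)
  show "closed {x. A x \<in> M}"
    using closed_vimage[OF closed_csubspace_closed[OF M] cont] by (simp add: vimage_def)
qed (use A M in \<open>auto simp: continuous_operator_def operator_zero operator_add operator_scaleC
    closed_csubspace_0 closed_csubspace_add closed_csubspace_scaleC\<close>)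

lemma closed_csubspace_equalizer:
  assumes A: "continuous_operator A" and B: "continuous_operator B"
  shows "closed_csubspace {x. A x = B x}"
proof (rule closed_csubspaceI)
  show "closed {x. A x = B x}"
    using A B by (intro closed_Collect_eq) (auto simp: continuous_operator_def)
qed (use A B in \<open>auto simp: continuous_operator_def operator_zero operator_add operator_scaleC\<close>)

text \<open>The points that \<open>A\<close> sends into the hull form a closed subspace containing
  \<open>S\<close>; invariance therefore needs checking on generators only.\<close>

lemma hull_invariant:
  assumes A: "continuous_operator A" and "\<And>x. x \<in> S \<Longrightarrow> A x \<in> closed_csubspace hull S"
    and "x \<in> closed_csubspace hull S"
  shows "A x \<in> closed_csubspace hull S"
proof -
  have "closed_csubspace hull S \<subseteq> {x. A x \<in> closed_csubspace hull S}"
    using assms by (intro hull_minimal closed_csubspace_preimage closed_csubspace_hull) auto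
  then show ?thesis using assms(3) by auto
qed

lemma hull_fixed:
  assumes "continuous_operator A" and "\<And>x. x \<in> S \<Longrightarrow> A x = x"
    and "x \<in> closed_csubspace hull S"
  shows "A x = x"
proof -
  have "closed_csubspace hull S \<subseteq> {x. A x = x}"
    using assms
    by (intro hull_minimal closed_csubspace_equalizer continuous_operator_id) auto
  then show ?thesis using assms(3) by auto
qed

subsection \<open>Isometries and their adjoints\<close>

abbreviation adj :: "('a::complex_hilbert_space \<Rightarrow> 'a) \<Rightarrow> 'a \<Rightarrow> 'a" where
  "adj \<equiv> adjoint_on UNIV"

lemma isometry_operator: "isometry_on UNIV T \<Longrightarrow> operator_on UNIV T"
  and isometry_norm: "isometry_on UNIV T \<Longrightarrow> norm (T x) = norm x"
  by (auto simp: isometry_on_def)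

lemma isometry_cinner:
  assumes "isometry_on UNIV T"
  shows "cinner (T x) (T y) = cinner x y"
  unfolding cinner_polarization
  using assms by (simp add: isometry_norm operator_add[OF isometry_operator, symmetric]
      operator_scaleC[OF isometry_operator, symmetric])

lemma operator_bounded_linear:
  assumes "operator_on UNIV A" "\<And>x. norm (A x) \<le> norm x"
  shows "bounded_linear A"
proof (rule bounded_linear_intro)
  show "A (r *\<^sub>R x) = r *\<^sub>R A x" for r x
    using operator_scaleC[OF assms(1), of "complex_of_real r" x] by (simp add: scaleC_of_real)
  show "norm (A x) \<le> norm x * 1" for x using assms(2) by simp
qed (rule operator_add[OF assms(1)])

lemma operator_continuous:
  assumes "operator_on UNIV A" "\<And>x. norm (A x) \<le> norm x"
  shows "continuous_operator A"
  using operator_bounded_linear[OF assms] assms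
  by (simp add: continuous_operator_def linear_continuous_on)

lemma continuous_operator_isometry:
  "isometry_on UNIV T \<Longrightarrow> continuous_operator T"
  by (simp add: operator_continuous isometry_operator isometry_norm)

lemma closed_csubspace_range_isometry:
  assumes T: "isometry_on UNIV T"
  shows "closed_csubspace (range T)"
proof -
  note op = isometry_operator[OF T]
  show ?thesis
  proof (rule closed_csubspaceI)
    show "0 \<in> range T" using operator_zero[OF op] by (metis rangeI)
    show "x + y \<in> range T" if "x \<in> range T" "y \<in> range T" for x y
      using that by (auto simp: operator_add[OF op, symmetric])
    show "a *\<^sub>C x \<in> range T" if "x \<in> range T" for a x
      using that by (auto simp: operator_scaleC[OF op, symmetric])
    have "complete (range T)"
    proof (rule complete_isometric_image)
      show "bounded_linear T"
        using T by (simp add: operator_bounded_linear op isometry_norm)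
    qed (use T in \<open>auto simp: isometry_norm complete_UNIV intro: zero_less_one\<close>)
    then show "closed (range T)" by (rule complete_imp_closed)
  qed
qed

text \<open>Two candidates differ by a vector of \<open>M\<close> orthogonal to \<open>M\<close>,
  hence by 0.\<close>

lemma adjoint_on_eqI:
  assumes M: "closed_csubspace M" and "z \<in> M" "\<And>x. x \<in> M \<Longrightarrow> cinner (T x) y = cinner x z"
  shows "adjoint_on M T y = z"
  unfolding adjoint_on_def
proof (rule the_equality)
  fix w assume w: "w \<in> M \<and> (\<forall>x\<in>M. cinner (T x) y = cinner x w)"
  then have "w - z \<in> M" using assms by (simp add: closed_csubspace_diff)
  then have "cinner (w - z) (w - z) = 0"
    using w assms by (metis cinner_diff_right right_minus_eq)
  then show "w = z" by simp
qed (use assms in auto)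

text \<open>Existence of the adjoint, which gives the \<open>THE\<close> in
  \<open>adjoint_on\<close> its meaning. The range of \<open>T\<close> is closed, so
  \<open>y\<close> splits into some \<open>T z\<close> and a vector orthogonal to the range; as
  \<open>T\<close> preserves inner products, \<open>z\<close> is the adjoint vector.\<close>

lemma cinner_adj:
  assumes T: "isometry_on UNIV T"
  shows "cinner (T x) y = cinner x (adj T y)"
proof -
  obtain v where "v \<in> range T" and v: "y - v \<in> orthogonal_complement (range T)"
    using orthogonal_decomposition[OF closed_csubspace_range_isometry[OF T]] .
  then obtain z where z: "v = T z" by auto
  have eq: "cinner (T x) y = cinner x z" for x
  proof -
    have "cinner (y - v) (T x) = 0" using v by (auto simp: orthogonal_complement_def)
    then have "cinner (T x) (y - v) = 0" by (simp add: cinner_eq_0_commute)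
    then show ?thesis using isometry_cinner[OF T, of x z] by (simp add: cinner_diff_right z)
  qed
  have "adj T y = z" by (rule adjoint_on_eqI) (auto simp: closed_csubspace_UNIV eq)
  with eq show ?thesis by simp
qed

lemma cinner_adj_left:
  assumes "isometry_on UNIV T"
  shows "cinner (adj T x) y = cinner x (T y)"
  by (metis assms cinner_adj cinner_commute)

lemma adj_eqI:
  assumes "\<And>x. cinner (T x) y = cinner x z"
  shows "adj T y = z"
  by (rule adjoint_on_eqI) (auto simp: closed_csubspace_UNIV assms)

lemma adj_isometry:
  "isometry_on UNIV T \<Longrightarrow> adj T (T x) = x"
  by (rule adj_eqI) (rule isometry_cinner)

lemma isometry_compose:
  "isometry_on UNIV S \<Longrightarrow> isometry_on UNIV T \<Longrightarrow> isometry_on UNIV (\<lambda>x. S (T x))"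
  by (auto simp: isometry_on_def operator_on_def)

lemma adj_compose:
  assumes "isometry_on UNIV S" "isometry_on UNIV T"
  shows "adj (\<lambda>x. S (T x)) x = adj T (adj S x)"
  by (rule adj_eqI) (simp add: cinner_adj assms)

text \<open>Expanding the square gives |T (adj T y) - y|^2 = |y|^2 - |adj T y|^2, so
  \<open>adj T\<close> is a contraction.\<close>

lemma continuous_operator_adj:
  assumes T: "isometry_on UNIV T"
  shows "continuous_operator (adj T)"
proof (rule operator_continuous)
  show "operator_on UNIV (adj T)"
    unfolding operator_on_def
    by (auto intro!: adj_eqI
        simp: cinner_add_right cinner_scaleC_right cinner_adj[OF T])
  show "norm (adj T y) \<le> norm y" for y
  proof -
    have "cinner (T (adj T y)) y = complex_of_real ((norm (adj T y))\<^sup>2)"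
      by (simp add: cinner_adj[OF T] cinner_self)
    then have "(norm (T (adj T y) - y))\<^sup>2 = (norm y)\<^sup>2 - (norm (adj T y))\<^sup>2"
      by (simp add: norm_diff_square isometry_norm[OF T] del: of_real_power)
    moreover have "0 \<le> (norm (T (adj T y) - y))\<^sup>2" by (rule zero_le_power2)
    ultimately have "(norm (adj T y))\<^sup>2 \<le> (norm y)\<^sup>2" by linarith
    then show ?thesis by (rule power2_le_imp_le) simp
  qed
qed

lemma operator_adj: "isometry_on UNIV T \<Longrightarrow> operator_on UNIV (adj T)"
  using continuous_operator_adj continuous_operator_def by blast

text \<open>The global adjoint vector already lies in \<open>M\<close>, so it also has the defining
  property relative to \<open>M\<close>. Later arguments can therefore work with the single operator
  \<open>adj T\<close>.\<close>

lemma adjoint_on_reducing: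
  assumes "isometry_on UNIV T" "reduces M T" "x \<in> M"
  shows "adjoint_on M T x = adj T x"
  using assms by (intro adjoint_on_eqI) (auto simp: reduces_def cinner_adj)

lemma isometry_on_invariant:
  "isometry_on UNIV T \<Longrightarrow> T ` M \<subseteq> M \<Longrightarrow> isometry_on M T"
  by (auto simp: isometry_on_def operator_on_def)

lemma unitary_on_reducing:
  assumes "isometry_on UNIV T" "reduces M T"
  shows "unitary_on M T \<longleftrightarrow> (\<forall>x\<in>M. T (adj T x) = x)"
proof -
  have inv: "T ` M \<subseteq> M" using assms by (simp add: reduces_def)
  have "adjoint_on M T (T x) = x \<and> adjoint_on M T x = adj T x" if "x \<in> M" for x
    using adjoint_on_reducing[OF assms that] adjoint_on_reducing[OF assms, of "T x"] that inv
    by (auto simp: adj_isometry[OF assms(1)])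
  then show ?thesis
    using isometry_on_invariant[OF assms(1) inv] by (simp add: unitary_on_def)
qed

lemma power_image_decreasing:
  assumes "A ` M \<subseteq> M" "i \<le> j"
  shows "(A ^^ j) ` M \<subseteq> (A ^^ i) ` M"
proof -
  have "(A ^^ k) ` M \<subseteq> M" for k
    using assms(1) by (induction k) (auto simp: image_subset_iff)
  moreover have "A ^^ j = (A ^^ i) \<circ> (A ^^ (j - i))"
    using assms(2) by (simp flip: funpow_add)
  ultimately show ?thesis by (auto simp: image_subset_iff)
qed

lemma closed_csubspace_power_image:
  assumes T: "isometry_on UNIV T" and M: "closed_csubspace M"
  shows "closed_csubspace ((T ^^ m) ` M)"
proof (induction m)
  case (Suc m)
  have "(T ^^ Suc m) ` M = T ` (T ^^ m) ` M" by (simp add: image_comp)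
  \<comment> \<open>An image under an isometry becomes an equalizer intersected with a preimage, and
    both of these are closed.\<close>
  also have "\<dots> = {x. T (adj T x) = x} \<inter> {x. adj T x \<in> (T ^^ m) ` M}"
    by (auto simp: adj_isometry[OF T] intro: image_eqI[of _ _ "adj T _"] )
  also have "closed_csubspace \<dots>"
    by (intro closed_csubspace_Int closed_csubspace_preimage closed_csubspace_equalizer
        continuous_operator_adj[OF T] continuous_operator_id Suc
        continuous_operator_compose[OF continuous_operator_isometry[OF T]])
  finally show ?case .
qed (use M in simp)

text \<open>\<open>B\<close> is a right inverse of \<open>A\<close> on \<open>C\<close>, so
  preimages can be taken within \<open>C\<close> forever. Purity of \<open>A\<close> on
  \<open>M\<close> then forces \<open>C\<close> into {0}; this is how purity of a single isometry is
  exploited.\<close>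

lemma subset_power_image:
  assumes "C \<subseteq> M" "\<And>x. x \<in> C \<Longrightarrow> B x \<in> C" "\<And>x. x \<in> C \<Longrightarrow> A (B x) = x"
  shows "C \<subseteq> (A ^^ m) ` M"
proof (induction m)
  case (Suc m)
  show ?case
  proof
    fix x assume "x \<in> C"
    then have "A (B x) \<in> A ` (A ^^ m) ` M" using Suc assms(2) by blast
    then show "x \<in> (A ^^ Suc m) ` M" using \<open>x \<in> C\<close> assms(3) by (simp add: image_comp)
  qed
qed (use assms in simp)

text \<open>Injectivity makes the preimages agree: if \<open>x\<close> lies in the range of every
  power, its preimage under \<open>T\<close> found at each stage is the same vector
  \<open>adj T x\<close>.\<close>

lemma image_Inter_power:
  assumes T: "isometry_on UNIV T" and inv: "T ` M \<subseteq> M"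
  shows "T ` (\<Inter>m. (T ^^ m) ` M) = (\<Inter>m. (T ^^ m) ` M)"
proof (intro equalityI subsetI)
  fix x assume "x \<in> T ` (\<Inter>m. (T ^^ m) ` M)"
  then obtain y where y: "x = T y" "\<And>m. y \<in> (T ^^ m) ` M" by auto
  have "x \<in> (T ^^ Suc m) ` M" for m using y(2)[of m] by (auto simp: y(1))
  then show "x \<in> (\<Inter>m. (T ^^ m) ` M)"
    using power_image_decreasing[OF inv, OF le_SucI, OF order_refl] by blast
next
  fix x assume x: "x \<in> (\<Inter>m. (T ^^ m) ` M)"
  have *: "adj T x \<in> (T ^^ m) ` M \<and> T (adj T x) = x" for m
  proof -
    have "x \<in> (T ^^ Suc m) ` M" using x by blast
    then show ?thesis by (auto simp: adj_isometry[OF T])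
  qed
  then have "adj T x \<in> (\<Inter>m. (T ^^ m) ` M)" by blast
  then show "x \<in> T ` (\<Inter>m. (T ^^ m) ` M)" using * by (metis imageI)
qed

lemma closed_csubspace_fixed_adj:
  assumes "isometry_on UNIV T"
  shows "closed_csubspace {x. T (adj T x) = x}"
  using closed_csubspace_equalizer[OF continuous_operator_compose[OF continuous_operator_isometry
        continuous_operator_adj, OF assms assms] continuous_operator_id] .

subsection \<open>Row isometries\<close>

lemma row_isometry_isometry:
  "row_isometry_on UNIV n V \<Longrightarrow> k \<in> {1..n} \<Longrightarrow> isometry_on UNIV (V k)"
  by (simp add: row_isometry_on_def)

lemma row_isometry_adj:
  assumes "row_isometry_on UNIV n V" "i \<in> {1..n}" "j \<in> {1..n}"
  shows "adj (V i) (V j x) = (if i = j then x else 0)"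
proof (cases "i = j")
  case True
  then show ?thesis using assms by (simp add: adj_isometry row_isometry_isometry)
next
  case False
  then have "cinner (V i y) (V j x) = 0" for y
    using assms by (auto simp: row_isometry_on_def orthogonal_sets_def)
  then show ?thesis using False by (auto intro: adj_eqI)
qed

lemma row_isometry_adj_sum:
  assumes V: "row_isometry_on UNIV n V" and i: "i \<in> {1..n}"
  shows "adj (V i) (\<Sum>k=1..n. V k (h k)) = h i"
proof -
  have "adj (V i) (\<Sum>k=1..n. V k (h k)) = (\<Sum>k=1..n. if i = k then h k else 0)"
    unfolding operator_sum[OF operator_adj[OF row_isometry_isometry[OF V i]]]
    by (rule sum.cong) (simp_all add: row_isometry_adj[OF V i])
  then show ?thesis using i by simp
qed

lemma row_isometry_on_invariant:
  assumes "row_isometry_on UNIV n V" "\<And>k. k \<in> {1..n} \<Longrightarrow> V k ` M \<subseteq> M"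
  shows "row_isometry_on M n V"
  unfolding row_isometry_on_def
proof (intro conjI ballI impI)
  show "isometry_on M (V i)" if "i \<in> {1..n}" for i
    using that assms by (blast intro: isometry_on_invariant[OF row_isometry_isometry])
  show "orthogonal_sets (V i ` M) (V j ` M)" if "i \<in> {1..n}" "j \<in> {1..n}" "i \<noteq> j" for i j
    using that assms(1) unfolding row_isometry_on_def orthogonal_sets_def by blast
qed

lemma row_unitary_on_reducing:
  assumes V: "row_isometry_on UNIV n V" and M: "\<And>k. k \<in> {1..n} \<Longrightarrow> reduces M (V k)"
  shows "row_unitary_on M n V \<longleftrightarrow> (\<forall>x\<in>M. (\<Sum>k=1..n. V k (adj (V k) x)) = x)"
proof -
  have "row_isometry_on M n V"
    using M by (intro row_isometry_on_invariant[OF V]) (simp add: reduces_def)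
  moreover have "(\<Sum>k=1..n. V k (adjoint_on M (V k) x)) = (\<Sum>k=1..n. V k (adj (V k) x))"
    if "x \<in> M" for x
    using adjoint_on_reducing[OF row_isometry_isometry[OF V] M that]
    by (intro sum.cong refl) metis
  ultimately show ?thesis by (auto simp: row_unitary_on_def)
qed

lemma word_range_0 [simp]: "word_range M n V 0 = M"
proof -
  have "words n 0 = {[]}" by (auto simp: words_def)
  then show ?thesis by (auto simp: word_range_def)
qed

lemma words_Suc: "words n (Suc m) = (\<lambda>(k, \<mu>). k # \<mu>) ` ({1..n} \<times> words n m)"
  by (auto simp: words_def length_Suc_conv image_iff)

text \<open>Peeling off the first letter of each word replaces sums over words by induction on the
  length.\<close>

lemma word_range_Suc:
  assumes V: "row_isometry_on UNIV n V"
  shows "word_range M n V (Suc m)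
    = {\<Sum>k=1..n. V k (h k) | h. \<forall>k\<in>{1..n}. h k \<in> word_range M n V m}"
proof -
  have op: "operator_on UNIV (V k)" if "k \<in> {1..n}" for k
    using that V by (simp add: row_isometry_isometry isometry_operator)
  have eq: "(\<Sum>\<mu>\<in>words n (Suc m). foldr V \<mu> (h \<mu>))
      = (\<Sum>k=1..n. V k (\<Sum>\<mu>\<in>words n m. foldr V \<mu> (h (k # \<mu>))))" for h
  proof -
    have "(\<Sum>\<mu>\<in>words n (Suc m). foldr V \<mu> (h \<mu>))
        = (\<Sum>(k, \<mu>)\<in>{1..n} \<times> words n m. foldr V (k # \<mu>) (h (k # \<mu>)))"
      unfolding words_Suc by (subst sum.reindex) (auto simp: inj_on_def case_prod_unfold)
    also have "\<dots> = (\<Sum>k=1..n. \<Sum>\<mu>\<in>words n m. V k (foldr V \<mu> (h (k # \<mu>))))"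
      by (simp add: sum.cartesian_product)
    also have "\<dots> = (\<Sum>k=1..n. V k (\<Sum>\<mu>\<in>words n m. foldr V \<mu> (h (k # \<mu>))))"
      by (intro sum.cong refl operator_sum[OF op, symmetric])
    finally show ?thesis .
  qed
  show ?thesis
  proof (intro equalityI subsetI)
    fix x assume "x \<in> word_range M n V (Suc m)"
    then obtain h where h: "\<And>\<mu>. \<mu> \<in> words n (Suc m) \<Longrightarrow> h \<mu> \<in> M"
      and x: "x = (\<Sum>\<mu>\<in>words n (Suc m). foldr V \<mu> (h \<mu>))"
      unfolding word_range_def by blast
    have "h (k # \<mu>) \<in> M" if "k \<in> {1..n}" "\<mu> \<in> words n m" for k \<mu>
      using that by (intro h) (auto simp: words_def)
    then have "(\<Sum>\<mu>\<in>words n m. foldr V \<mu> (h (k # \<mu>))) \<in> word_range M n V m"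
      if "k \<in> {1..n}" for k
      unfolding word_range_def using that
      by (intro CollectI exI[of _ "\<lambda>\<mu>. h (k # \<mu>)"]) simp
    then show "x \<in> {\<Sum>k=1..n. V k (h k) | h. \<forall>k\<in>{1..n}. h k \<in> word_range M n V m}"
      unfolding x eq
      by (intro CollectI exI[of _ "\<lambda>k. \<Sum>\<mu>\<in>words n m. foldr V \<mu> (h (k # \<mu>))"]) simp
  next
    fix x assume "x \<in> {\<Sum>k=1..n. V k (h k) | h. \<forall>k\<in>{1..n}. h k \<in> word_range M n V m}"
    then obtain h where x: "x = (\<Sum>k=1..n. V k (h k))"
      and "\<forall>k\<in>{1..n}. h k \<in> word_range M n V m" by blast
    then have "\<forall>k\<in>{1..n}. \<exists>g. h k = (\<Sum>\<mu>\<in>words n m. foldr V \<mu> (g \<mu>)) \<and> (\<forall>\<mu>\<in>words n m. g \<mu> \<in> M)"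
      unfolding word_range_def by simp
    from bchoice[OF this] obtain g where
      g: "\<forall>k\<in>{1..n}. h k = (\<Sum>\<mu>\<in>words n m. foldr V \<mu> (g k \<mu>)) \<and> (\<forall>\<mu>\<in>words n m. g k \<mu> \<in> M)"
      by blast
    \<comment> \<open>The coefficient families chosen for the different first letters are glued into
      one function on words: the head selects the family, the tail the entry.\<close>
    have "x = (\<Sum>\<mu>\<in>words n (Suc m). foldr V \<mu> (g (hd \<mu>) (tl \<mu>)))"
      unfolding x eq by (intro sum.cong) (simp_all add: g)
    moreover have "\<forall>\<mu>\<in>words n (Suc m). g (hd \<mu>) (tl \<mu>) \<in> M"
      unfolding words_Suc using g by auto
    ultimately show "x \<in> word_range M n V (Suc m)"
      unfolding word_range_def by (intro CollectI exI[of _ "\<lambda>\<mu>. g (hd \<mu>) (tl \<mu>)"]) simp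
  qed
qed

text \<open>Orthogonality of the ranges forces the coefficients in \<open>word_range_Suc\<close> to
  be \<open>h k = adj (V k) x\<close>. Membership thus becomes a condition on \<open>x\<close>
  itself, without a choice of coefficients, and closedness can be read off.\<close>

lemma word_range_Suc_adj:
  assumes V: "row_isometry_on UNIV n V"
  shows "word_range M n V (Suc m) = {x. (\<Sum>k=1..n. V k (adj (V k) x)) = x} \<inter>
    (\<Inter>k\<in>{1..n}. {x. adj (V k) x \<in> word_range M n V m})"
proof -
  show ?thesis
  proof (intro equalityI subsetI)
    fix x assume "x \<in> word_range M n V (Suc m)"
    then obtain h where x: "x = (\<Sum>k=1..n. V k (h k))"
      and h: "\<forall>k\<in>{1..n}. h k \<in> word_range M n V m"
      unfolding word_range_Suc[OF V] by blast
    have adj: "adj (V k) x = h k" if "k \<in> {1..n}" for k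
      unfolding x by (rule row_isometry_adj_sum[OF V that])
    have "(\<Sum>k=1..n. V k (adj (V k) x)) = (\<Sum>k=1..n. V k (h k))"
      by (rule sum.cong) (simp_all add: adj)
    with adj show "x \<in> {x. (\<Sum>k=1..n. V k (adj (V k) x)) = x} \<inter>
        (\<Inter>k\<in>{1..n}. {x. adj (V k) x \<in> word_range M n V m})"
      using h x by simp
  next
    fix x assume "x \<in> {x. (\<Sum>k=1..n. V k (adj (V k) x)) = x} \<inter>
        (\<Inter>k\<in>{1..n}. {x. adj (V k) x \<in> word_range M n V m})"
    then show "x \<in> word_range M n V (Suc m)"
      unfolding word_range_Suc[OF V]
      by (intro CollectI exI[of _ "\<lambda>k. adj (V k) x"]) auto
  qed
qed

lemma continuous_operator_row_sum:
  assumes "row_isometry_on UNIV n V"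
  shows "continuous_operator (\<lambda>x. \<Sum>k=1..n. V k (adj (V k) x))"
proof (rule continuous_operator_sum)
  fix k assume "k \<in> {1..n}"
  then have "isometry_on UNIV (V k)" by (rule row_isometry_isometry[OF assms])
  then show "continuous_operator (\<lambda>x. V k (adj (V k) x))"
    by (intro continuous_operator_compose[of "V k" "adj (V k)"] continuous_operator_isometry
        continuous_operator_adj)
qed

lemma closed_csubspace_word_range:
  assumes V: "row_isometry_on UNIV n V" and M: "closed_csubspace M"
  shows "closed_csubspace (word_range M n V m)"
proof (induction m)
  case (Suc m)
  show ?case
    unfolding word_range_Suc_adj[OF V]
  proof (intro closed_csubspace_Int closed_csubspace_Inter)
    show "closed_csubspace {x. (\<Sum>k=1..n. V k (adj (V k) x)) = x}"
      by (rule closed_csubspace_equalizer[OF continuous_operator_row_sum[OF V] continuous_operator_id])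
    fix N assume "N \<in> (\<lambda>k. {x. adj (V k) x \<in> word_range M n V m}) ` {1..n}"
    then show "closed_csubspace N"
      by (auto intro!: closed_csubspace_preimage continuous_operator_adj row_isometry_isometry[OF V] Suc)
  qed
qed (simp add: M)

text \<open>Row version of \<open>subset_power_image\<close>: \<open>adj (V k)\<close> supplies
  coefficients within \<open>C\<close> at every level.\<close>

lemma subset_word_range:
  assumes V: "row_isometry_on UNIV n V"
    and "C \<subseteq> M" "\<And>k x. k \<in> {1..n} \<Longrightarrow> x \<in> C \<Longrightarrow> adj (V k) x \<in> C"
      "\<And>x. x \<in> C \<Longrightarrow> (\<Sum>k=1..n. V k (adj (V k) x)) = x"
  shows "C \<subseteq> word_range M n V m"
proof (induction m)
  case (Suc m)
  then show ?case using assms unfolding word_range_Suc_adj[OF V] by auto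
qed (simp add: assms)

text \<open>An element of level \<open>Suc m\<close> is the sum of its pieces
  \<open>V k (adj (V k) x)\<close>, so a linear \<open>A\<close> need only be tested on vectors
  \<open>V k y\<close> with \<open>y\<close> of level \<open>m\<close>. With \<open>A\<close> the
  identity this proves inclusions.\<close>

lemma word_range_Suc_induct:
  assumes V: "row_isometry_on UNIV n V" and x: "x \<in> word_range M n V (Suc m)"
    and A: "operator_on UNIV A" and R: "closed_csubspace R"
    and step: "\<And>k y. k \<in> {1..n} \<Longrightarrow> y \<in> word_range M n V m \<Longrightarrow> A (V k y) \<in> R"
  shows "A x \<in> R"
proof -
  have "A x = (\<Sum>k=1..n. A (V k (adj (V k) x)))"
    using x unfolding word_range_Suc_adj[OF V] by (simp add: operator_sum[OF A, symmetric])
  also have "\<dots> \<in> R"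
    using x unfolding word_range_Suc_adj[OF V]
    by (intro closed_csubspace_sum[OF R] step) auto
  finally show ?thesis .
qed

lemma word_range_SucI:
  assumes V: "row_isometry_on UNIV n V" and M: "closed_csubspace M"
    and k: "k \<in> {1..n}" and y: "y \<in> word_range M n V m"
  shows "V k y \<in> word_range M n V (Suc m)"
proof -
  have op: "operator_on UNIV (V j)" if "j \<in> {1..n}" for j
    using that V by (simp add: row_isometry_isometry isometry_operator)
  have "V k y = (\<Sum>j=1..n. V j (if j = k then y else 0))"
  proof -
    have "(\<Sum>j=1..n. V j (if j = k then y else 0)) = (\<Sum>j=1..n. if j = k then V j y else 0)"
      by (rule sum.cong) (auto simp: operator_zero[OF op])
    then show ?thesis using k by simp
  qed
  moreover have "\<forall>j\<in>{1..n}. (if j = k then y else 0) \<in> word_range M n V m"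
    using y closed_csubspace_0[OF closed_csubspace_word_range[OF V M]] by auto
  ultimately show ?thesis
    unfolding word_range_Suc[OF V]
    by (intro CollectI exI[of _ "\<lambda>j. if j = k then y else 0"] conjI)
qed

lemma word_range_decreasing:
  assumes V: "row_isometry_on UNIV n V" and M: "closed_csubspace M"
    and inv: "\<And>k x. k \<in> {1..n} \<Longrightarrow> x \<in> M \<Longrightarrow> V k x \<in> M"
  shows "word_range M n V (Suc m) \<subseteq> word_range M n V m"
proof (induction m)
  case 0
  show ?case
    using word_range_Suc_induct[OF V _ operator_on_id M, of _ M 0] inv by auto
next
  case (Suc m)
  show ?case
  proof
    fix x assume x: "x \<in> word_range M n V (Suc (Suc m))"
    show "x \<in> word_range M n V (Suc m)"
    proof (rule word_range_Suc_induct[OF V x operator_on_id closed_csubspace_word_range[OF V M]])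
      fix k y assume "k \<in> {1..n}" "y \<in> word_range M n V (Suc m)"
      then show "V k y \<in> word_range M n V (Suc m)"
        using word_range_SucI[OF V M] Suc by blast
    qed
  qed
qed

lemma operator_on_row_sum:
  "row_isometry_on UNIV n V \<Longrightarrow> operator_on UNIV (\<lambda>x. \<Sum>k=1..n. V k (adj (V k) x))"
  using continuous_operator_row_sum continuous_operator_def by blast

text \<open>\<open>A c - c\<close> lies in \<open>M\<close>, but it also equals (x - c) - A (x - c),
  which is orthogonal to \<open>M\<close>. This transfers a fixed point \<open>x\<close> of
  \<open>A\<close> to its component in \<open>M\<close>.\<close>

lemma fixed_component:
  assumes M: "closed_csubspace M" and A: "operator_on UNIV A"
    and inv: "\<And>y. y \<in> M \<Longrightarrow> A y \<in> M"
    and inv': "\<And>y. y \<in> orthogonal_complement M \<Longrightarrow> A y \<in> orthogonal_complement M"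
    and "A x = x" "c \<in> M" "x - c \<in> orthogonal_complement M"
  shows "A c = c"
proof -
  have "A c - c = (x - c) - A (x - c)"
    using \<open>A x = x\<close> by (simp add: operator_diff[OF A])
  then have "A c - c \<in> orthogonal_complement M"
    using assms closed_csubspace_diff[OF closed_csubspace_orthogonal_complement] by metis
  moreover have "A c - c \<in> M" using assms by (simp add: closed_csubspace_diff)
  ultimately show ?thesis using orthogonal_complement_Int[OF M] by fastforce
qed

subsection \<open>Representations of the odometer semigroup\<close>

locale odometer_rep =
  fixes n :: nat
    and W :: "'a::complex_hilbert_space \<Rightarrow> 'a"
    and V :: "nat \<Rightarrow> 'a \<Rightarrow> 'a"
  assumes n_pos: "n \<ge> 1"
    and rep: "odometer_rep_on UNIV n W V"
begin

lemma W_isometry: "isometry_on UNIV W"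
  and V_row: "row_isometry_on UNIV n V"
  and W_V: "k \<in> {1..<n} \<Longrightarrow> W (V k x) = V (k + 1) x"
  and W_V_last: "W (V n x) = V 1 (W x)"
  using rep by (auto simp: odometer_rep_on_def)

lemmas V_isometry = row_isometry_isometry[OF V_row]
lemmas W_operator = isometry_operator[OF W_isometry]
  and V_operator = isometry_operator[OF V_isometry]
  and adj_W_operator = operator_adj[OF W_isometry]
  and adj_V_operator = operator_adj[OF V_isometry]

lemma adj_V_adj_W: "k \<in> {1..<n} \<Longrightarrow> adj (V k) (adj W x) = adj (V (k + 1)) x"
proof -
  assume k: "k \<in> {1..<n}"
  have "adj (V k) (adj W x) = adj (\<lambda>x. W (V k x)) x"
    using k by (intro adj_compose[symmetric] W_isometry V_isometry) auto
  also have "(\<lambda>x. W (V k x)) = V (k + 1)" using k by (simp add: W_V)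
  finally show ?thesis .
qed

lemma adj_V_last_adj_W: "adj (V n) (adj W x) = adj W (adj (V 1) x)"
proof -
  have "adj (V n) (adj W x) = adj (\<lambda>x. W (V n x)) x"
    using n_pos by (intro adj_compose[symmetric] W_isometry V_isometry) auto
  also have "(\<lambda>x. W (V n x)) = (\<lambda>x. V 1 (W x))" by (simp add: W_V_last)
  also have "adj \<dots> x = adj W (adj (V 1) x)"
    using n_pos by (intro adj_compose W_isometry V_isometry) auto
  finally show ?thesis .
qed

lemma adj_V_W: "k \<in> {1..<n} \<Longrightarrow> adj (V (k + 1)) (W x) = adj (V k) x"
  by (simp only: adj_V_adj_W[symmetric] adj_isometry[OF W_isometry])

lemma adj_W_V: "k \<in> {1..<n} \<Longrightarrow> adj W (V (k + 1) x) = V k x"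
  by (simp only: W_V[symmetric] adj_isometry[OF W_isometry])

lemma index_cases:
  assumes "k \<in> {1..n}"
  obtains "k \<in> {1..<n}" | "k = n"
  using assms by (cases "k = n") auto

lemma index_cases':
  assumes "k \<in> {1..n}"
  obtains "k = 1" | j where "k = j + 1" "j \<in> {1..<n}"
proof (cases "k = 1")
  case False
  with assms have "k = (k - 1) + 1" "k - 1 \<in> {1..<n}" by auto
  then show ?thesis using that by blast
qed (use that in blast)

lemma W_power_V: "k \<ge> 1 \<Longrightarrow> k + j \<le> n \<Longrightarrow> (W ^^ j) (V k x) = V (k + j) x"
proof (induction j)
  case (Suc j)
  then show ?case using W_V[of "k + j"] by simp
qed simp

text \<open>One full turn of the odometer: n - k steps raise the digit k to n, one step resets it to
  1 and carries into \<open>x\<close>, and k - 1 steps restore it.\<close>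

lemma W_power_n_V:
  assumes k: "k \<in> {1..n}"
  shows "(W ^^ n) (V k x) = V k (W x)"
proof -
  have "n = (k - 1) + Suc (n - k)" using k by auto
  then have "(W ^^ n) (V k x) = (W ^^ (k - 1)) (W ((W ^^ (n - k)) (V k x)))"
    by (metis comp_apply funpow.simps(2) funpow_add)
  also have "(W ^^ (n - k)) (V k x) = V n x" using k W_power_V[of k "n - k"] by auto
  also have "(W ^^ (k - 1)) (W (V n x)) = V k (W x)"
    using k W_power_V[of 1 "k - 1"] by (auto simp: W_V_last)
  finally show ?thesis .
qed

lemma W_power_mult_V: "k \<in> {1..n} \<Longrightarrow> (W ^^ (n * m)) (V k x) = V k ((W ^^ m) x)"
  by (induction m arbitrary: x) (simp_all add: funpow_add W_power_n_V)

text \<open>Division with remainder: \<open>m mod n\<close> moves the first digit, counted from 1,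
  and \<open>m div n\<close> is the carry handed to \<open>x\<close>.\<close>

lemma W_power_V_first: "(W ^^ m) (V 1 x) = V (m mod n + 1) ((W ^^ (m div n)) x)"
proof -
  have "(W ^^ m) (V 1 x) = (W ^^ (m mod n)) ((W ^^ (n * (m div n))) (V 1 x))"
    by (metis comp_apply funpow_add mod_mult_div_eq add.commute mult.commute)
  also have "(W ^^ (n * (m div n))) (V 1 x) = V 1 ((W ^^ (m div n)) x)"
    using n_pos by (simp add: W_power_mult_V)
  also have "(W ^^ (m mod n)) (V 1 ((W ^^ (m div n)) x)) = V (m mod n + 1) ((W ^^ (m div n)) x)"
    using n_pos W_power_V[of 1 "m mod n"] by (simp add: Suc_leI)
  finally show ?thesis .
qed

text \<open>The third family of \<open>weak_bishift_on\<close>. By \<open>T_eq\<close> it is just W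
  V_1, ..., W V_n, so its ranges lie in the range of \<open>W\<close> and
  \<open>adj W (T k x) = V k x\<close>.\<close>

definition "T = (\<lambda>k. if k < n then V (k + 1) else V 1 \<circ> W)"

lemma T_eq: "k \<in> {1..n} \<Longrightarrow> T k x = W (V k x)"
  by (auto simp: T_def W_V W_V_last elim!: index_cases)

lemma T_row: "row_isometry_on UNIV n T"
  unfolding row_isometry_on_def
proof (intro conjI ballI impI)
  show "isometry_on UNIV (T i)" if "i \<in> {1..n}" for i
    using isometry_compose[OF W_isometry V_isometry[OF that]] that
    by (simp add: T_eq isometry_on_def operator_on_def)
  show "orthogonal_sets (range (T i)) (range (T j))"
    if "i \<in> {1..n}" "j \<in> {1..n}" "i \<noteq> j" for i j
  proof -
    have "orthogonal_sets (range (V i)) (range (V j))"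
      using V_row that by (simp add: row_isometry_on_def)
    then show ?thesis
      using that by (auto simp: orthogonal_sets_def T_eq isometry_cinner[OF W_isometry])
  qed
qed

lemma adj_T: "k \<in> {1..n} \<Longrightarrow> adj (T k) x = adj (V k) (adj W x)"
proof -
  assume k: "k \<in> {1..n}"
  have "T k = (\<lambda>x. W (V k x))" using k by (auto simp: T_eq)
  then show ?thesis using adj_compose[OF W_isometry V_isometry[OF k]] by simp
qed

section \<open>Jointly reducing subspaces\<close>

definition reducing :: "'a set \<Rightarrow> bool" where
  "reducing M \<longleftrightarrow> closed_csubspace M \<and> (\<forall>x\<in>M. W x \<in> M \<and> adj W x \<in> M) \<and>
    (\<forall>k\<in>{1..n}. \<forall>x\<in>M. V k x \<in> M \<and> adj (V k) x \<in> M)"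

lemma reducing_iff: "reducing M \<longleftrightarrow> reduces M W \<and> (\<forall>i\<in>{1..n}. reduces M (V i))"
  by (auto simp: reducing_def reduces_def image_subset_iff)

lemma reducingD:
  assumes "reducing M"
  shows reducing_closed: "closed_csubspace M"
    and reducing_W: "x \<in> M \<Longrightarrow> W x \<in> M"
    and reducing_adj_W: "x \<in> M \<Longrightarrow> adj W x \<in> M"
    and reducing_V: "k \<in> {1..n} \<Longrightarrow> x \<in> M \<Longrightarrow> V k x \<in> M"
    and reducing_adj_V: "k \<in> {1..n} \<Longrightarrow> x \<in> M \<Longrightarrow> adj (V k) x \<in> M"
  using assms by (auto simp: reducing_def)

lemma reducing_W_power: "reducing M \<Longrightarrow> x \<in> M \<Longrightarrow> (W ^^ m) x \<in> M"
  by (induction m) (auto simp: reducing_W)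

lemma reducing_V_power: "reducing M \<Longrightarrow> x \<in> M \<Longrightarrow> (V 1 ^^ m) x \<in> M"
  using n_pos by (induction m) (auto simp: reducing_V)

lemma reducing_Int: "reducing M \<Longrightarrow> reducing N \<Longrightarrow> reducing (M \<inter> N)"
  by (auto simp: reducing_def closed_csubspace_Int)

text \<open>The collection of \<open>W\<close>, the \<open>V k\<close> and their adjoints is closed
  under taking adjoints, and an operator preserves the complement of whatever its adjoint
  preserves.\<close>

lemma reducing_orthogonal_complement:
  assumes M: "reducing M"
  shows "reducing (orthogonal_complement M)"
proof -
  have "A x \<in> orthogonal_complement M"
    if "x \<in> orthogonal_complement M" "\<And>x y. cinner (A x) y = cinner x (B y)"
      "\<And>y. y \<in> M \<Longrightarrow> B y \<in> M" for A B x
    using that by (simp add: orthogonal_complement_def)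
  note * = this
  show ?thesis
    unfolding reducing_def
  proof (intro conjI ballI closed_csubspace_orthogonal_complement)
    fix x assume x: "x \<in> orthogonal_complement M"
    show "W x \<in> orthogonal_complement M" "adj W x \<in> orthogonal_complement M"
      by (rule *[OF x], rule cinner_adj[OF W_isometry], rule reducing_adj_W[OF M], assumption)
        (rule *[OF x], rule cinner_adj_left[OF W_isometry], rule reducing_W[OF M], assumption)
    fix k assume k: "k \<in> {1..n}"
    show "V k x \<in> orthogonal_complement M" "adj (V k) x \<in> orthogonal_complement M"
      by (rule *[OF x], rule cinner_adj[OF V_isometry[OF k]], rule reducing_adj_V[OF M k], assumption)
        (rule *[OF x], rule cinner_adj_left[OF V_isometry[OF k]], rule reducing_V[OF M k], assumption)
  qed
qed

lemma reducing_hull: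
  assumes "\<And>x. x \<in> S \<Longrightarrow> W x \<in> closed_csubspace hull S"
    "\<And>x. x \<in> S \<Longrightarrow> adj W x \<in> closed_csubspace hull S"
    "\<And>k x. k \<in> {1..n} \<Longrightarrow> x \<in> S \<Longrightarrow> V k x \<in> closed_csubspace hull S"
    "\<And>k x. k \<in> {1..n} \<Longrightarrow> x \<in> S \<Longrightarrow> adj (V k) x \<in> closed_csubspace hull S"
  shows "reducing (closed_csubspace hull S)"
  unfolding reducing_def
proof (intro conjI ballI closed_csubspace_hull)
  fix x assume x: "x \<in> closed_csubspace hull S"
  show "W x \<in> closed_csubspace hull S" "adj W x \<in> closed_csubspace hull S"
    using hull_invariant[OF continuous_operator_isometry[OF W_isometry] assms(1) x]
      hull_invariant[OF continuous_operator_adj[OF W_isometry] assms(2) x] by simp_all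
  fix k assume k: "k \<in> {1..n}"
  show "V k x \<in> closed_csubspace hull S" "adj (V k) x \<in> closed_csubspace hull S"
    using hull_invariant[OF continuous_operator_isometry[OF V_isometry[OF k]] assms(3)[OF k] x]
      hull_invariant[OF continuous_operator_adj[OF V_isometry[OF k]] assms(4)[OF k] x] by simp_all
qed

text \<open>Only the nontrivial half of unitarity is recorded; \<open>adj W (W x) = x\<close> holds
  for every isometry.\<close>

definition W_unitary :: "'a set \<Rightarrow> bool" where
  "W_unitary M \<longleftrightarrow> reducing M \<and> (\<forall>x\<in>M. W (adj W x) = x)"

definition V_unitary :: "'a set \<Rightarrow> bool" where
  "V_unitary M \<longleftrightarrow> reducing M \<and> (\<forall>x\<in>M. (\<Sum>k=1..n. V k (adj (V k) x)) = x)"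

lemma W_unitary_subset: "W_unitary M \<Longrightarrow> reducing N \<Longrightarrow> N \<subseteq> M \<Longrightarrow> W_unitary N"
  by (auto simp: W_unitary_def)

lemma V_unitary_subset: "V_unitary M \<Longrightarrow> reducing N \<Longrightarrow> N \<subseteq> M \<Longrightarrow> V_unitary N"
  by (auto simp: V_unitary_def)

lemma W_unitary_hull:
  assumes "reducing (closed_csubspace hull S)" "\<And>x. x \<in> S \<Longrightarrow> W (adj W x) = x"
  shows "W_unitary (closed_csubspace hull S)"
  unfolding W_unitary_def
proof (intro conjI ballI)
  fix x assume "x \<in> closed_csubspace hull S"
  then show "W (adj W x) = x"
    using hull_fixed[OF continuous_operator_compose[OF continuous_operator_isometry
          continuous_operator_adj, OF W_isometry W_isometry] assms(2)] by simp
qed (rule assms)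

lemma V_unitary_hull:
  assumes "reducing (closed_csubspace hull S)"
    "\<And>x. x \<in> S \<Longrightarrow> (\<Sum>k=1..n. V k (adj (V k) x)) = x"
  shows "V_unitary (closed_csubspace hull S)"
  unfolding V_unitary_def
proof (intro conjI ballI)
  fix x assume "x \<in> closed_csubspace hull S"
  then show "(\<Sum>k=1..n. V k (adj (V k) x)) = x"
    using hull_fixed[OF continuous_operator_row_sum[OF V_row] assms(2)] by simp
qed (rule assms)

section \<open>The largest reducing subspaces with a unitary constituent\<close>

definition "max_W_unitary = closed_csubspace hull (\<Union>{M. W_unitary M})"

definition "max_V_unitary = closed_csubspace hull (\<Union>{M. V_unitary M})"

text \<open>The spaces \<open>max_W_unitary\<close> and \<open>max_V_unitary\<close> are
  \<open>KW\<close> and \<open>KV\<close> of the overview. Being fixed by W (adj W x) and being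
  mapped into the hull are closed linear conditions, so they pass from all \<open>W_unitary\<close>
  subspaces to the closed span of their union.\<close>

lemma W_unitary_max: "W_unitary max_W_unitary"
  unfolding max_W_unitary_def
proof (intro W_unitary_hull reducing_hull)
  fix x assume "x \<in> \<Union>{M. W_unitary M}"
  then obtain M where M: "W_unitary M" "x \<in> M" by blast
  then have sub: "M \<subseteq> closed_csubspace hull \<Union>{M. W_unitary M}"
    by (metis Union_upper hull_subset mem_Collect_eq subset_trans)
  have red: "reducing M" using M by (simp add: W_unitary_def)
  show "W x \<in> closed_csubspace hull \<Union>{M. W_unitary M}"
    "adj W x \<in> closed_csubspace hull \<Union>{M. W_unitary M}"
    using sub M(2) red by (auto dest: reducing_W reducing_adj_W)
  show "V k x \<in> closed_csubspace hull \<Union>{M. W_unitary M}"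
    "adj (V k) x \<in> closed_csubspace hull \<Union>{M. W_unitary M}" if "k \<in> {1..n}" for k
    using sub M(2) reducing_V[OF red that] reducing_adj_V[OF red that] by auto
  show "W (adj W x) = x" using M by (auto simp: W_unitary_def)
qed

lemma V_unitary_max: "V_unitary max_V_unitary"
  unfolding max_V_unitary_def
proof (intro V_unitary_hull reducing_hull)
  fix x assume "x \<in> \<Union>{M. V_unitary M}"
  then obtain M where M: "V_unitary M" "x \<in> M" by blast
  then have sub: "M \<subseteq> closed_csubspace hull \<Union>{M. V_unitary M}"
    by (metis Union_upper hull_subset mem_Collect_eq subset_trans)
  have red: "reducing M" using M by (simp add: V_unitary_def)
  show "W x \<in> closed_csubspace hull \<Union>{M. V_unitary M}"
    "adj W x \<in> closed_csubspace hull \<Union>{M. V_unitary M}"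
    using sub M(2) red by (auto dest: reducing_W reducing_adj_W)
  show "V k x \<in> closed_csubspace hull \<Union>{M. V_unitary M}"
    "adj (V k) x \<in> closed_csubspace hull \<Union>{M. V_unitary M}" if "k \<in> {1..n}" for k
    using sub M(2) reducing_V[OF red that] reducing_adj_V[OF red that] by auto
  show "(\<Sum>k=1..n. V k (adj (V k) x)) = x" using M by (auto simp: V_unitary_def)
qed

lemma W_unitary_le_max: "W_unitary M \<Longrightarrow> M \<subseteq> max_W_unitary"
  unfolding max_W_unitary_def by (auto intro: hull_inc)

lemma V_unitary_le_max: "V_unitary M \<Longrightarrow> M \<subseteq> max_V_unitary"
  unfolding max_V_unitary_def by (auto intro: hull_inc)

text \<open>\<open>C\<close> is the orthogonal projection of \<open>N\<close> onto \<open>M\<close>.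
  As \<open>M\<close> and its complement are both reducing, \<open>C\<close> inherits from
  \<open>N\<close> the invariance under \<open>adj W\<close> and the equation
  \<open>W (adj W c) = c\<close>; hence it lies in the range of every power and vanishes.\<close>

lemma W_unitary_orthogonal_pure:
  assumes N: "W_unitary N" and M: "reducing M" and pure: "(\<Inter>m. (W ^^ m) ` M) = {0}"
  shows "N \<subseteq> orthogonal_complement M"
proof
  define C where "C = {c \<in> M. \<exists>x\<in>N. x - c \<in> orthogonal_complement M}"
  note M' = reducing_orthogonal_complement[OF M]
  have red: "reducing N" and fix_N: "W (adj W x) = x" if "x \<in> N" for x
    using N that by (auto simp: W_unitary_def)
  have "C \<subseteq> (W ^^ m) ` M" for m
  proof (rule subset_power_image[where B = "adj W"])
    fix c assume "c \<in> C"
    then obtain x where x: "x \<in> N" "x - c \<in> orthogonal_complement M" and c: "c \<in> M"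
      by (auto simp: C_def)
    have "adj W x - adj W c \<in> orthogonal_complement M"
      using reducing_adj_W[OF M' x(2)] by (simp add: operator_diff[OF adj_W_operator])
    then show "adj W c \<in> C"
      using x c reducing_adj_W[OF M c] reducing_adj_W[OF red x(1)] by (auto simp: C_def)
    show "W (adj W c) = c"
    proof (rule fixed_component[OF reducing_closed[OF M] _ _ _ _ c x(2)])
      show "operator_on UNIV (\<lambda>x. W (adj W x))"
        using W_operator adj_W_operator by (auto simp: operator_on_def)
    qed (use M M' x fix_N in \<open>auto intro: reducing_W reducing_adj_W\<close>)
  qed (auto simp: C_def)
  then have C: "C \<subseteq> {0}" using pure by blast
  fix x assume x: "x \<in> N"
  obtain c where "c \<in> M" "x - c \<in> orthogonal_complement M"
    using orthogonal_decomposition[OF reducing_closed[OF M]] .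
  moreover from this x have "c \<in> C" by (auto simp: C_def)
  ultimately show "x \<in> orthogonal_complement M" using C by auto
qed

text \<open>The argument of \<open>W_unitary_orthogonal_pure\<close>, with the row sum of
  \<open>V k (adj (V k) c)\<close> in place of \<open>W (adj W c)\<close>.\<close>

lemma V_unitary_orthogonal_pure:
  assumes N: "V_unitary N" and M: "reducing M" and pure: "(\<Inter>m. word_range M n V m) = {0}"
  shows "N \<subseteq> orthogonal_complement M"
proof
  define C where "C = {c \<in> M. \<exists>x\<in>N. x - c \<in> orthogonal_complement M}"
  note M' = reducing_orthogonal_complement[OF M]
  have red: "reducing N" and fix_N: "\<And>x. x \<in> N \<Longrightarrow> (\<Sum>k=1..n. V k (adj (V k) x)) = x"
    using N by (auto simp: V_unitary_def)
  have "C \<subseteq> word_range M n V m" for m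
  proof (rule subset_word_range[OF V_row])
    fix c assume "c \<in> C"
    then obtain x where x: "x \<in> N" "x - c \<in> orthogonal_complement M" and c: "c \<in> M"
      by (auto simp: C_def)
    show "adj (V k) c \<in> C" if k: "k \<in> {1..n}" for k
    proof -
      have "adj (V k) x - adj (V k) c \<in> orthogonal_complement M"
        using reducing_adj_V[OF M' k x(2)] by (simp add: operator_diff[OF adj_V_operator[OF k]])
      then show ?thesis
        using x c reducing_adj_V[OF M k c] reducing_adj_V[OF red k x(1)] by (auto simp: C_def)
    qed
    show "(\<Sum>k=1..n. V k (adj (V k) c)) = c"
      by (rule fixed_component[OF reducing_closed[OF M] operator_on_row_sum[OF V_row] _ _ _ c x(2)])
        (use M M' x fix_N in \<open>auto intro!: closed_csubspace_sum reducing_closed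
          reducing_V reducing_adj_V simp del: One_nat_def\<close>)
  qed (auto simp: C_def)
  then have C: "C \<subseteq> {0}" using pure by blast
  fix x assume x: "x \<in> N"
  obtain c where "c \<in> M" "x - c \<in> orthogonal_complement M"
    using orthogonal_decomposition[OF reducing_closed[OF M]] .
  moreover from this x have "c \<in> C" by (auto simp: C_def)
  ultimately show "x \<in> orthogonal_complement M" using C by auto
qed

text \<open>The relations carry words in \<open>T\<close> to words in \<open>T\<close>: W T_k =
  T_{k+1} for k < n, W T_n = T_1 W, V_1 T_k = T_n V_k and V_{j+1} T_k = T_j T_k. Both claims go
  through one induction, since \<open>T k y = W (V k y)\<close> stays at level \<open>m\<close> by
  the two hypotheses together.\<close>

lemma word_range_T_invariant:
  assumes M: "reducing M"
  shows "x \<in> word_range M n T m \<Longrightarrow> W x \<in> word_range M n T m"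
    and "i \<in> {1..n} \<Longrightarrow> x \<in> word_range M n T m \<Longrightarrow> V i x \<in> word_range M n T m"
proof -
  note closed = closed_csubspace_word_range[OF T_row reducing_closed[OF M]]
    and T_mem = word_range_SucI[OF T_row reducing_closed[OF M]]
  have "(\<forall>x\<in>word_range M n T m. W x \<in> word_range M n T m) \<and>
    (\<forall>i\<in>{1..n}. \<forall>x\<in>word_range M n T m. V i x \<in> word_range M n T m)"
  proof (induction m)
    case 0
    then show ?case by (simp add: reducing_W[OF M] reducing_V[OF M])
  next
    case (Suc m)
    show ?case
    proof (intro conjI ballI)
      fix x assume x: "x \<in> word_range M n T (Suc m)"
      show "W x \<in> word_range M n T (Suc m)"
      proof (rule word_range_Suc_induct[OF T_row x W_operator closed])
        fix k y assume k: "k \<in> {1..n}" and y: "y \<in> word_range M n T m"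
        from k show "W (T k y) \<in> word_range M n T (Suc m)"
        proof (cases rule: index_cases)
          case 1
          then have "W (T k y) = T (k + 1) y" by (simp add: T_eq W_V)
          then show ?thesis using T_mem[OF _ y, of "k + 1"] 1 by auto
        next
          case 2
          then have "W (T k y) = T 1 (W y)" using n_pos by (simp add: T_eq W_V_last)
          then show ?thesis using T_mem[of 1 "W y"] y Suc n_pos by auto
        qed
      qed
      fix i assume i: "i \<in> {1..n}"
      show "V i x \<in> word_range M n T (Suc m)"
      proof (rule word_range_Suc_induct[OF T_row x V_operator[OF i] closed])
        fix k y assume k: "k \<in> {1..n}" and y: "y \<in> word_range M n T m"
        then have Vy: "V k y \<in> word_range M n T m" and Ty: "T k y \<in> word_range M n T m"
          using Suc by (auto simp: T_eq)
        from i show "V i (T k y) \<in> word_range M n T (Suc m)"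
        proof (cases rule: index_cases')
          case 1
          then have "V i (T k y) = T n (V k y)"
            using k n_pos by (simp add: T_eq W_V_last)
          then show ?thesis using T_mem[OF _ Vy, of n] n_pos by auto
        next
          case (2 j)
          then have "V i (T k y) = T j (T k y)" by (simp add: T_eq[of j] W_V)
          then show ?thesis using T_mem[OF _ Ty, of j] 2 by auto
        qed
      qed
    qed
  qed
  then show "x \<in> word_range M n T m \<Longrightarrow> W x \<in> word_range M n T m"
    "i \<in> {1..n} \<Longrightarrow> x \<in> word_range M n T m \<Longrightarrow> V i x \<in> word_range M n T m"
    by blast+
qed

text \<open>\<open>adj W\<close> and \<open>adj (V i)\<close> cost one level, as adj W T_k = V_k and
  each T_k is V_{k+1} or V_1 W; the intersection over all levels absorbs the loss. Level one already
  lies in the range of \<open>W\<close>.\<close>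

lemma W_unitary_Inter_word_range_T:
  assumes M: "reducing M"
  shows "W_unitary (\<Inter>m. word_range M n T m)"
proof -
  note closed = closed_csubspace_word_range[OF T_row reducing_closed[OF M]]
  have adj_W: "adj W x \<in> word_range M n T m" if x: "x \<in> word_range M n T (Suc m)" for x m
    by (rule word_range_Suc_induct[OF T_row x adj_W_operator closed])
      (simp add: T_eq adj_isometry[OF W_isometry] word_range_T_invariant(2)[OF M])
  have adj_V: "adj (V i) x \<in> word_range M n T m"
    if x: "x \<in> word_range M n T (Suc m)" and i: "i \<in> {1..n}" for x m i
  proof (rule word_range_Suc_induct[OF T_row x adj_V_operator[OF i] closed])
    fix k y assume k: "k \<in> {1..n}" and y: "y \<in> word_range M n T m"
    obtain j z where "T k y = V j z" "j \<in> {1..n}" "z \<in> word_range M n T m"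
      using k
    proof (cases rule: index_cases)
      case 1
      with y show thesis by (intro that[of "k + 1" y]) (auto simp: T_eq W_V)
    next
      case 2
      with y n_pos show thesis
        by (intro that[of 1 "W y"]) (auto simp: T_eq W_V_last word_range_T_invariant(1)[OF M])
    qed
    then show "adj (V i) (T k y) \<in> word_range M n T m"
      using i by (simp add: row_isometry_adj[OF V_row] closed_csubspace_0[OF closed])
  qed
  have W_adj_W: "W (adj W x) = x" if x: "x \<in> word_range M n T (Suc 0)" for x
    using word_range_Suc_induct[OF T_row x operator_on_id
        closed_csubspace_fixed_adj[OF W_isometry]]
    by (simp add: T_eq adj_isometry[OF W_isometry])
  show ?thesis
    unfolding W_unitary_def reducing_def
    by (intro conjI ballI closed_csubspace_Inter)
      (use closed adj_W adj_V word_range_T_invariant[OF M] in \<open>auto intro: W_adj_W\<close>)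
qed

text \<open>Each level is invariant under \<open>W\<close> and, thanks to unitarity of
  \<open>W\<close> on \<open>N\<close>, under \<open>adj W\<close>; only \<open>adj (V k)\<close>
  drops a level, which the intersection absorbs.\<close>

lemma V_unitary_Inter_word_range_V:
  assumes N: "W_unitary N"
  shows "V_unitary (\<Inter>m. word_range N n V m)"
proof -
  have red: "reducing N" and fix_N: "\<And>x. x \<in> N \<Longrightarrow> W (adj W x) = x"
    using N by (auto simp: W_unitary_def)
  note closed = closed_csubspace_word_range[OF V_row reducing_closed[OF red]]
    and V_mem = word_range_SucI[OF V_row reducing_closed[OF red]]
    and decreasing = word_range_decreasing[OF V_row reducing_closed[OF red] reducing_V[OF red]]
  have sub: "word_range N n V m \<subseteq> N" for m
    using decreasing by (induction m) auto
  have inv: "(\<forall>x\<in>word_range N n V m. W x \<in> word_range N n V m) \<and>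
    (\<forall>x\<in>word_range N n V m. adj W x \<in> word_range N n V m)" for m
  proof (induction m)
    case 0
    then show ?case by (simp add: reducing_W[OF red] reducing_adj_W[OF red])
  next
    case (Suc m)
    show ?case
    proof (intro conjI ballI)
      fix x assume x: "x \<in> word_range N n V (Suc m)"
      show "W x \<in> word_range N n V (Suc m)"
      proof (rule word_range_Suc_induct[OF V_row x W_operator closed])
        fix k y assume k: "k \<in> {1..n}" and y: "y \<in> word_range N n V m"
        from k show "W (V k y) \<in> word_range N n V (Suc m)"
        proof (cases rule: index_cases)
          case 1
          then show ?thesis using V_mem[OF _ y, of "k + 1"] by (simp add: W_V)
        next
          case 2
          then show ?thesis using V_mem[of 1 "W y"] Suc y n_pos by (simp add: W_V_last)
        qed
      qed
      show "adj W x \<in> word_range N n V (Suc m)"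
      proof (rule word_range_Suc_induct[OF V_row x adj_W_operator closed])
        fix k y assume k: "k \<in> {1..n}" and y: "y \<in> word_range N n V m"
        from k show "adj W (V k y) \<in> word_range N n V (Suc m)"
        proof (cases rule: index_cases')
          case 1
          \<comment> \<open>Writing \<open>y\<close> as \<open>W (adj W y)\<close> allows W V_n =
            V_1 W to be read backwards; this is where unitarity on \<open>N\<close> enters.\<close>
          have "V 1 y = W (V n (adj W y))"
            using fix_N[OF subsetD[OF sub y]] by (simp add: W_V_last)
          then have "adj W (V k y) = V n (adj W y)" using 1 by (simp add: adj_isometry[OF W_isometry])
          then show ?thesis using V_mem[of n "adj W y"] Suc y n_pos by simp
        next
          case (2 j)
          then have "adj W (V k y) = V j y" using adj_W_V[of j y] by simp
          then show ?thesis using V_mem[OF _ y, of j] 2 by simp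
        qed
      qed
    qed
  qed
  have V_inv: "V k x \<in> word_range N n V m" if "k \<in> {1..n}" "x \<in> word_range N n V m" for k x m
    using V_mem[OF that] decreasing by blast
  have adj_V: "adj (V k) x \<in> word_range N n V m" if "k \<in> {1..n}" "x \<in> word_range N n V (Suc m)"
    for k x m
    using that unfolding word_range_Suc_adj[OF V_row] by auto
  have fix_V: "(\<Sum>k=1..n. V k (adj (V k) x)) = x" if "x \<in> word_range N n V (Suc 0)" for x
    using that unfolding word_range_Suc_adj[OF V_row] by auto
  show ?thesis
    unfolding V_unitary_def reducing_def
    by (intro conjI ballI closed_csubspace_Inter)
      (use closed inv V_inv adj_V in \<open>auto intro!: fix_V simp del: One_nat_def\<close>)
qed

text \<open>Pulling \<open>V k\<close> through a power of \<open>W\<close> multiplies the exponent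
  by \<open>n\<close> (\<open>W_power_mult_V\<close>). For \<open>V k\<close> this is harmless, as
  the ranges decrease; for \<open>adj (V k)\<close> the vector is taken as W^(n m) y and
  \<open>y\<close> is expanded along the row, which is where row unitarity on \<open>N\<close>
  enters.\<close>

lemma W_unitary_Inter_power:
  assumes N: "V_unitary N"
  shows "W_unitary (\<Inter>m. (W ^^ m) ` N)"
proof -
  have red: "reducing N" and fix_N: "\<And>x. x \<in> N \<Longrightarrow> (\<Sum>k=1..n. V k (adj (V k) x)) = x"
    using N by (auto simp: V_unitary_def)
  have W_inv: "W ` N \<subseteq> N" using red by (auto simp: reducing_W)
  define P where "P = (\<Inter>m. (W ^^ m) ` N)"
  have W_P: "W ` P = P" unfolding P_def by (rule image_Inter_power[OF W_isometry W_inv])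
  have "adj W x \<in> P \<and> W (adj W x) = x" if "x \<in> P" for x
  proof -
    have "x \<in> W ` P" using W_P that by simp
    then obtain y where "y \<in> P" "x = W y" by blast
    then show ?thesis by (simp add: adj_isometry[OF W_isometry])
  qed
  moreover have "V k x \<in> P" if k: "k \<in> {1..n}" and "x \<in> P" for k x
    unfolding P_def
  proof
    fix m
    obtain y where y: "y \<in> N" "x = (W ^^ m) y" using \<open>x \<in> P\<close> by (auto simp: P_def)
    then have "V k x = (W ^^ (n * m)) (V k y)" using k by (simp add: W_power_mult_V)
    then have "V k x \<in> (W ^^ (n * m)) ` N" using y reducing_V[OF red k] by simp
    moreover have "m \<le> n * m" using n_pos by simp
    ultimately show "V k x \<in> (W ^^ m) ` N" using power_image_decreasing[OF W_inv] by blast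
  qed
  moreover have "adj (V k) x \<in> P" if k: "k \<in> {1..n}" and "x \<in> P" for k x
    unfolding P_def
  proof
    fix m
    obtain y where y: "y \<in> N" "x = (W ^^ (n * m)) y" using \<open>x \<in> P\<close> by (auto simp: P_def)
    have op: "operator_on UNIV (W ^^ l)" for l
      using W_operator by (induction l) (auto simp: operator_on_def)
    have "x = (W ^^ (n * m)) (\<Sum>k=1..n. V k (adj (V k) y))" using y fix_N by simp
    also have "\<dots> = (\<Sum>k=1..n. (W ^^ (n * m)) (V k (adj (V k) y)))" by (rule operator_sum[OF op])
    also have "\<dots> = (\<Sum>k=1..n. V k ((W ^^ m) (adj (V k) y)))"
      by (rule sum.cong) (simp_all add: W_power_mult_V)
    finally have "adj (V k) x = (W ^^ m) (adj (V k) y)"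
      using row_isometry_adj_sum[OF V_row k] by simp
    then show "adj (V k) x \<in> (W ^^ m) ` N" using y reducing_adj_V[OF red k] by simp
  qed
  moreover have "closed_csubspace P"
    unfolding P_def
    using closed_csubspace_power_image[OF W_isometry reducing_closed[OF red]]
    by (intro closed_csubspace_Inter) auto
  moreover have "W x \<in> P" if "x \<in> P" for x using imageI[OF that, of W] W_P by simp
  ultimately show ?thesis by (simp add: W_unitary_def reducing_def flip: P_def)
qed

subsection \<open>Weak bi-shifts\<close>

text \<open>When \<open>M\<close> is reducing, this is the largest \<open>W\<close>-invariant part
  of the wandering space of the row in \<open>M\<close>; \<open>W_defect\<close> is its counterpart
  for \<open>V 1\<close> and the kernel of \<open>adj W\<close>. On such \<open>M\<close> the global
  adjoint agrees with \<open>adjoint_on M\<close>.\<close>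

definition V_defect :: "'a set \<Rightarrow> 'a set" where
  "V_defect M = {x\<in>M. \<forall>i\<in>{1..n}. \<forall>j. adj (V i) ((W ^^ j) x) = 0}"

definition W_defect :: "'a set \<Rightarrow> 'a set" where
  "W_defect M = {x\<in>M. \<forall>j. adj W ((V 1 ^^ j) x) = 0}"

lemma W_V_defect: "reducing M \<Longrightarrow> W ` V_defect M \<subseteq> V_defect M"
proof -
  have "adj (V i) ((W ^^ j) (W x)) = adj (V i) ((W ^^ Suc j) x)" for i j x
    by (simp add: funpow_swap1)
  then show "reducing M \<Longrightarrow> W ` V_defect M \<subseteq> V_defect M"
    by (auto simp: V_defect_def reducing_W simp del: funpow.simps)
qed

lemma V_W_defect: "reducing M \<Longrightarrow> V 1 ` W_defect M \<subseteq> W_defect M"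
proof -
  have "adj W ((V 1 ^^ j) (V 1 x)) = adj W ((V 1 ^^ Suc j) x)" for j x
    by (simp add: funpow_swap1)
  then show "reducing M \<Longrightarrow> V 1 ` W_defect M \<subseteq> W_defect M"
    using n_pos by (auto simp: W_defect_def reducing_V simp del: funpow.simps One_nat_def)
qed

text \<open>The isometry and relation clauses pass to every reducing subspace, so only the three
  purity clauses carry content.\<close>

lemma weak_bishift_on_reducing:
  assumes M: "reducing M"
  shows "weak_bishift_on M n W V \<longleftrightarrow> (\<Inter>m. (W ^^ m) ` V_defect M) = {0} \<and>
    (\<Inter>m. (V 1 ^^ m) ` W_defect M) = {0} \<and> (\<Inter>m. word_range M n T m) = {0}"
proof -
  have one: "1 \<in> {1..n}" using n_pos by simp
  have redW: "reduces M W" and redV: "\<And>i. i \<in> {1..n} \<Longrightarrow> reduces M (V i)"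
    using M by (auto simp: reducing_iff)
  have 1: "adjoint_on M (V i) ((W ^^ j) x) = adj (V i) ((W ^^ j) x)"
    if "i \<in> {1..n}" "x \<in> M" for i j x
    using that by (intro adjoint_on_reducing V_isometry redV reducing_W_power[OF M])
  have 2: "adjoint_on M W ((V 1 ^^ j) x) = adj W ((V 1 ^^ j) x)" if "x \<in> M" for j x
    using that by (intro adjoint_on_reducing W_isometry redW reducing_V_power[OF M])
  have "{x\<in>M. \<forall>i\<in>{1..n}. \<forall>j. adjoint_on M (V i) ((W ^^ j) x) = 0} = V_defect M"
    unfolding V_defect_def using 1 by auto
  moreover have "{x\<in>M. \<forall>j. adjoint_on M W ((V 1 ^^ j) x) = 0} = W_defect M"
    unfolding W_defect_def using 2 by auto
  moreover have "isometry_on (V_defect M) W"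
    by (rule isometry_on_invariant[OF W_isometry W_V_defect[OF M]])
  moreover have "isometry_on (W_defect M) (V 1)"
    by (rule isometry_on_invariant[OF V_isometry[OF one] V_W_defect[OF M]])
  moreover have "row_isometry_on M n T"
  proof (rule row_isometry_on_invariant[OF T_row])
    show "T k ` M \<subseteq> M" if "k \<in> {1..n}" for k
      using reducing_W[OF M reducing_V[OF M that]] that by (auto simp: T_eq)
  qed
  moreover have "odometer_rep_on M n W V"
  proof -
    have "isometry_on M W"
      using reducing_W[OF M] by (intro isometry_on_invariant[OF W_isometry]) blast
    moreover have "row_isometry_on M n V"
      using reducing_V[OF M] by (intro row_isometry_on_invariant[OF V_row]) blast
    ultimately show ?thesis by (simp add: odometer_rep_on_def W_V W_V_last)
  qed
  ultimately show ?thesis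
    unfolding weak_bishift_on_def pure_isometry_on_def pure_row_isometry_on_def T_def by simp
qed

lemma weak_bishift_W_unitary:
  assumes M: "reducing M" and bishift: "weak_bishift_on M n W V"
    and N: "W_unitary N" and "N \<subseteq> M"
  shows "N \<subseteq> {0}"
proof -
  have pure_W: "(\<Inter>m. (W ^^ m) ` V_defect M) = {0}" and pure_T: "(\<Inter>m. word_range M n T m) = {0}"
    using bishift M by (auto simp: weak_bishift_on_reducing)
  have red: "reducing N" and fix_N: "\<And>x. x \<in> N \<Longrightarrow> W (adj W x) = x"
    using N by (auto simp: W_unitary_def)
  \<comment> \<open>\<open>W\<close> maps the wandering subspace \<open>E\<close> onto itself, so purity of \<open>W\<close> on \<open>V_defect M\<close> forces
    \<open>E = 0\<close>; then \<open>T\<close> is a row unitary on \<open>N\<close>, against its purity on \<open>M\<close>.\<close>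
  define E where "E = {x \<in> N. \<forall>i\<in>{1..n}. adj (V i) x = 0}"
  have W_E: "W x \<in> E" if x: "x \<in> E" for x
    unfolding E_def
  proof (intro CollectI conjI ballI)
    show "W x \<in> N" using x red by (auto simp: E_def reducing_W)
    fix i assume i: "i \<in> {1..n}"
    then show "adj (V i) (W x) = 0"
    proof (cases rule: index_cases')
      case 1
      define z where "z = adj (V 1) (W x)"
      have "z \<in> N"
        using \<open>W x \<in> N\<close> i 1 by (auto simp: z_def intro: reducing_adj_V[OF red])
      \<comment> \<open>On \<open>N\<close> the vector \<open>z\<close> is
        \<open>W (adj W z)\<close>; then V_1 W = W V_n brings a \<open>W\<close> to the front that
        cancels against the one in \<open>W x\<close>, and \<open>adj (V n) x = 0\<close>
        finishes.\<close>
      have "cinner z z = cinner (W x) (V 1 (W (adj W z)))"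
        using i 1 fix_N[OF \<open>z \<in> N\<close>] by (simp add: z_def cinner_adj_left[OF V_isometry])
      also have "\<dots> = cinner x (V n (adj W z))"
        by (simp only: W_V_last[symmetric] isometry_cinner[OF W_isometry])
      also have "\<dots> = cinner (adj (V n) x) (adj W z)"
        using n_pos by (simp add: cinner_adj_left[OF V_isometry])
      also have "\<dots> = 0" using x n_pos by (simp add: E_def)
      finally show ?thesis using 1 by (simp add: z_def)
    next
      case (2 j)
      then show ?thesis using x adj_V_W[of j x] by (simp add: E_def)
    qed
  qed
  have adj_W_E: "adj W x \<in> E" if x: "x \<in> E" for x
    unfolding E_def
  proof (intro CollectI conjI ballI)
    show "adj W x \<in> N" using x red by (auto simp: E_def reducing_adj_W)
    fix i assume "i \<in> {1..n}"
    then show "adj (V i) (adj W x) = 0"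
    proof (cases rule: index_cases)
      case 1
      then show ?thesis using x by (simp add: adj_V_adj_W E_def)
    next
      case 2
      then show ?thesis
        using x n_pos by (simp add: adj_V_last_adj_W E_def operator_zero[OF adj_W_operator])
    qed
  qed
  have "(W ^^ j) x \<in> E" if "x \<in> E" for j x
    using that by (induction j) (auto simp: W_E)
  then have "E \<subseteq> V_defect M"
    using \<open>N \<subseteq> M\<close> unfolding V_defect_def by (auto simp: E_def)
  then have "E \<subseteq> (W ^^ m) ` V_defect M" for m
    by (rule subset_power_image[OF _ adj_W_E]) (auto simp: E_def fix_N)
  then have E: "E \<subseteq> {0}" using pure_W by blast
  have fix_V: "(\<Sum>k=1..n. V k (adj (V k) x)) = x" if x: "x \<in> N" for x
  proof -
    \<comment> \<open>What remains of \<open>x\<close> after removing its components along the row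
      is annihilated by every \<open>adj (V i)\<close>.\<close>
    have "x - (\<Sum>k=1..n. V k (adj (V k) x)) \<in> E"
      unfolding E_def
    proof (intro CollectI conjI ballI)
      show "x - (\<Sum>k=1..n. V k (adj (V k) x)) \<in> N"
        using x red by (intro closed_csubspace_diff closed_csubspace_sum reducing_closed
            reducing_V reducing_adj_V)
      show "adj (V i) (x - (\<Sum>k=1..n. V k (adj (V k) x))) = 0" if i: "i \<in> {1..n}" for i
        using row_isometry_adj_sum[OF V_row i] by (simp add: operator_diff[OF adj_V_operator[OF i]])
    qed
    then show ?thesis using E by auto
  qed
  have "N \<subseteq> word_range M n T m" for m
  proof (rule subset_word_range[OF T_row \<open>N \<subseteq> M\<close>])
    fix x assume x: "x \<in> N"
    show "adj (T k) x \<in> N" if k: "k \<in> {1..n}" for k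
      using x red k by (simp add: adj_T reducing_adj_V reducing_adj_W)
    have "(\<Sum>k=1..n. T k (adj (T k) x)) = (\<Sum>k=1..n. W (V k (adj (V k) (adj W x))))"
      by (rule sum.cong) (simp_all add: T_eq adj_T)
    also have "\<dots> = W (\<Sum>k=1..n. V k (adj (V k) (adj W x)))"
      by (simp add: operator_sum[OF W_operator])
    also have "\<dots> = x"
      using x red by (simp add: fix_V fix_N reducing_adj_W del: One_nat_def)
    finally show "(\<Sum>k=1..n. T k (adj (T k) x)) = x" .
  qed
  then show ?thesis using pure_T by blast
qed

lemma weak_bishift_V_unitary:
  assumes M: "reducing M" and bishift: "weak_bishift_on M n W V"
    and N: "V_unitary N" and "N \<subseteq> M"
  shows "N \<subseteq> {0}"
proof -
  have pure_V: "(\<Inter>m. (V 1 ^^ m) ` W_defect M) = {0}"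
    using bishift M by (auto simp: weak_bishift_on_reducing)
  have red: "reducing N" and fix_N: "\<And>x. x \<in> N \<Longrightarrow> (\<Sum>k=1..n. V k (adj (V k) x)) = x"
    using N by (auto simp: V_unitary_def)
  have one: "1 \<in> {1..n}" using n_pos by simp
  \<comment> \<open>\<open>V 1\<close> maps \<open>E\<close> onto itself, so \<open>E = 0\<close> and \<open>W\<close> is unitary on \<open>N\<close>.\<close>
  define E where "E = {x \<in> N. adj W x = 0}"
  have V_E: "V 1 x \<in> E" if x: "x \<in> E" for x
    unfolding E_def
  proof (intro CollectI conjI)
    show V1: "V 1 x \<in> N" using x reducing_V[OF red one] by (simp add: E_def)
    define z where "z = adj W (V 1 x)"
    have "z \<in> N" using V1 by (simp add: z_def reducing_adj_W[OF red])
    \<comment> \<open>The vector \<open>z\<close> will be expanded along the row unitary. For k < n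
      the term lies in the range of \<open>V (k + 1)\<close>, orthogonal to that of
      \<open>V 1\<close>; for k = n the relation cancels \<open>V 1\<close> and leaves
      \<open>x\<close> against the range of \<open>W\<close>.\<close>
    have "cinner (V 1 x) (W (V k (adj (V k) z))) = 0" if k: "k \<in> {1..n}" for k
      using k
    proof (cases rule: index_cases)
      case 1
      have "cinner (V 1 x) (V (k + 1) (adj (V k) z)) = cinner x (adj (V 1) (V (k + 1) (adj (V k) z)))"
        by (rule cinner_adj[OF V_isometry[OF one]])
      also have "\<dots> = 0" using 1 one by (subst row_isometry_adj[OF V_row]) auto
      finally show ?thesis using 1 by (simp add: W_V)
    next
      case 2
      then have "cinner (V 1 x) (W (V k (adj (V k) z))) = cinner x (W (adj (V n) z))"
        by (simp only: W_V_last isometry_cinner[OF V_isometry[OF one]])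
      also have "\<dots> = cinner (adj W x) (adj (V n) z)" by (simp add: cinner_adj_left[OF W_isometry])
      also have "\<dots> = 0" using x by (simp add: E_def)
      finally show ?thesis .
    qed
    then have "cinner (V 1 x) (W (\<Sum>k=1..n. V k (adj (V k) z))) = 0"
      by (simp add: operator_sum[OF W_operator] cinner_sum_right)
    then have "cinner z z = 0"
      using fix_N[OF \<open>z \<in> N\<close>] cinner_adj_left[OF W_isometry, of "V 1 x" z] by (simp add: z_def)
    then show "adj W (V 1 x) = 0" by (simp add: z_def)
  qed
  have adj_V_E: "adj (V 1) x \<in> E \<and> V 1 (adj (V 1) x) = x" if x: "x \<in> E" for x
  proof -
    \<comment> \<open>For k = j + 1 the operator \<open>adj (V k)\<close> factors through
      \<open>adj W\<close>, which vanishes on \<open>E\<close>; so \<open>x\<close> has only a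
      component along \<open>V 1\<close>.\<close>
    have "adj (V k) x = 0" if "k \<in> {1..n}" "k \<noteq> 1" for k
      using that(1)
    proof (cases rule: index_cases')
      case (2 j)
      then show ?thesis
        using x adj_V_adj_W[of j x] by (simp add: E_def operator_zero[OF adj_V_operator])
    qed (use that in simp)
    then have "V k (adj (V k) x) = (if k = 1 then V 1 (adj (V 1) x) else 0)"
      if "k \<in> {1..n}" for k
      using that operator_zero[OF V_operator[OF that]] by auto
    then have "(\<Sum>k=1..n. V k (adj (V k) x)) = (\<Sum>k=1..n. if k = 1 then V 1 (adj (V 1) x) else 0)"
      by (intro sum.cong refl)
    then have "V 1 (adj (V 1) x) = x"
      using fix_N x one by (simp add: E_def)
    moreover have "adj W (adj (V 1) x) = 0"
      using x n_pos adj_V_last_adj_W[of x] by (simp add: E_def operator_zero[OF adj_V_operator])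
    ultimately show ?thesis using x reducing_adj_V[OF red one] by (simp add: E_def)
  qed
  have "(V 1 ^^ j) x \<in> E" if "x \<in> E" for j x
    using that by (induction j) (auto simp: V_E simp del: One_nat_def)
  then have "E \<subseteq> W_defect M"
    using \<open>N \<subseteq> M\<close> unfolding W_defect_def by (auto simp: E_def)
  then have "E \<subseteq> (V 1 ^^ m) ` W_defect M" for m
    by (rule subset_power_image[where B = "adj (V 1)"]) (use adj_V_E in auto)
  then have E: "E \<subseteq> {0}" using pure_V by blast
  have "W (adj W x) = x" if x: "x \<in> N" for x
  proof -
    have "x - W (adj W x) \<in> E"
      using x red by (auto simp: E_def operator_diff[OF adj_W_operator] adj_isometry[OF W_isometry]
          intro!: closed_csubspace_diff reducing_closed reducing_W reducing_adj_W)
    then show ?thesis using E by auto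
  qed
  \<comment> \<open>The other two purity clauses now take over through the \<open>W\<close>-unitary
    case.\<close>
  then have "W_unitary N" using red by (simp add: W_unitary_def)
  then show ?thesis using weak_bishift_W_unitary[OF M bishift] \<open>N \<subseteq> M\<close> by blast
qed

section \<open>Reducing subspaces generated by defect vectors\<close>

inductive_set V_orbit :: "'a set \<Rightarrow> 'a set" for P where
  base: "x \<in> P \<Longrightarrow> x \<in> V_orbit P"
| step: "x \<in> V_orbit P \<Longrightarrow> k \<in> {1..n} \<Longrightarrow> V k x \<in> V_orbit P"

text \<open>\<open>W\<close> acts on words as an odometer: it raises the first letter and, after
  \<open>n\<close>, carries into the rest. Since \<open>W\<close> maps \<open>P\<close> onto itself,
  the step can be undone by lowering the first letter and, at 1, borrowing from the rest.\<close>

lemma V_orbit_W: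
  assumes "W ` P = P" "x \<in> V_orbit P"
  shows "W x \<in> V_orbit P \<and> (\<exists>y\<in>V_orbit P. x = W y)"
  using assms(2)
proof (induction rule: V_orbit.induct)
  case (base x)
  then have "x \<in> W ` P" "W x \<in> P" using assms(1) by auto
  then show ?case using V_orbit.base by blast
next
  case (step x k)
  then obtain y where y: "y \<in> V_orbit P" "x = W y" by blast
  have "W (V k x) \<in> V_orbit P"
    using step(2)
  proof (cases rule: index_cases)
    case 1
    then show ?thesis using V_orbit.step[OF step(1), of "k + 1"] by (simp add: W_V)
  next
    case 2
    then show ?thesis using V_orbit.step[of "W x" P 1] step n_pos by (simp add: W_V_last)
  qed
  moreover have "\<exists>z\<in>V_orbit P. V k x = W z"
    using step(2)
  proof (cases rule: index_cases')
    case 1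
    then have "V k x = W (V n y)" by (simp add: y W_V_last)
    then show ?thesis using V_orbit.step[OF y(1), of n] n_pos by auto
  next
    case (2 j)
    then have "V k x = W (V j x)" by (simp add: W_V)
    then show ?thesis using V_orbit.step[OF step(1), of j] 2 by auto
  qed
  ultimately show ?case by blast
qed

text \<open>\<open>adj (V k)\<close> either strips the first letter of a word or gives 0; at the
  empty word it gives 0 by \<open>ker\<close>.\<close>

lemma W_unitary_hull_V_orbit:
  assumes P: "W ` P = P" and ker: "\<And>k x. k \<in> {1..n} \<Longrightarrow> x \<in> P \<Longrightarrow> adj (V k) x = 0"
  shows "W_unitary (closed_csubspace hull V_orbit P)"
proof (intro W_unitary_hull reducing_hull)
  have zero: "0 \<in> closed_csubspace hull V_orbit P"
    by (rule closed_csubspace_0[OF closed_csubspace_hull])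
  fix x assume x: "x \<in> V_orbit P"
  obtain y where y: "y \<in> V_orbit P" "x = W y" using V_orbit_W[OF P x] by blast
  show "W x \<in> closed_csubspace hull V_orbit P" using V_orbit_W[OF P x] by (auto intro: hull_inc)
  show "adj W x \<in> closed_csubspace hull V_orbit P" "W (adj W x) = x"
    using y by (simp_all add: adj_isometry[OF W_isometry] hull_inc)
  fix k assume k: "k \<in> {1..n}"
  show "V k x \<in> closed_csubspace hull V_orbit P"
    by (intro hull_inc V_orbit.step x k)
  show "adj (V k) x \<in> closed_csubspace hull V_orbit P"
    using x
  proof cases
    case base
    then show ?thesis using ker[OF k] zero by simp
  next
    case (step z j)
    then show ?thesis
      using zero
      by (simp add: row_isometry_adj[OF V_row k] hull_inc del: atLeastAtMost_iff)
  qed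
qed

lemma row_sum_V:
  assumes "j \<in> {1..n}"
  shows "(\<Sum>k=1..n. V k (adj (V k) (V j x))) = V j x"
proof -
  have "(\<Sum>k=1..n. V k (adj (V k) (V j x))) = (\<Sum>k=1..n. if k = j then V j x else 0)"
    using assms operator_zero[OF V_operator]
    by (intro sum.cong) (auto simp: row_isometry_adj[OF V_row] simp del: atLeastAtMost_iff)
  then show ?thesis using assms by simp
qed

text \<open>Because \<open>V 1\<close> maps \<open>P\<close> onto itself, each orbit vector is
  \<open>(W ^^ m) (V 1 z)\<close>, which odometer arithmetic places in the range of a single
  \<open>V j\<close>. On such a vector the row sum is the identity, and \<open>adj (V k)\<close>
  gives 0 or an orbit vector.\<close>

lemma V_unitary_hull_W_orbit:
  assumes P: "V 1 ` P = P" and ker: "\<And>x. x \<in> P \<Longrightarrow> adj W x = 0"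
  shows "V_unitary (closed_csubspace hull (\<Union>m. (W ^^ m) ` P))"
proof -
  define S where "S = (\<Union>m. (W ^^ m) ` P)"
  have W_S: "(W ^^ m) x \<in> S" if "x \<in> P" for m x using that by (auto simp: S_def)
  have zero: "0 \<in> closed_csubspace hull S"
    by (rule closed_csubspace_0[OF closed_csubspace_hull])
  have "V_unitary (closed_csubspace hull S)"
  proof (intro V_unitary_hull reducing_hull)
    fix x assume "x \<in> S"
    then obtain m y where y: "y \<in> P" and x: "x = (W ^^ m) y" by (auto simp: S_def)
    from y P have "y \<in> V 1 ` P" by simp
    then obtain z where z: "z \<in> P" "y = V 1 z" by blast
    define j where "j = m mod n + 1"
    have j: "j \<in> {1..n}" using n_pos by (simp add: j_def Suc_leI)
    have xz: "x = V j ((W ^^ (m div n)) z)"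
      unfolding x z(2) j_def by (rule W_power_V_first)
    show "W x \<in> closed_csubspace hull S"
      using W_S[OF y, of "Suc m"] by (simp add: x hull_inc)
    show "adj W x \<in> closed_csubspace hull S"
    proof (cases m)
      case 0
      then show ?thesis using ker[OF y] zero by (simp add: x)
    next
      case (Suc l)
      then show ?thesis using W_S[OF y, of l] by (simp add: x adj_isometry[OF W_isometry] hull_inc)
    qed
    show "(\<Sum>k=1..n. V k (adj (V k) x)) = x" unfolding xz by (rule row_sum_V[OF j])
    fix k assume k: "k \<in> {1..n}"
    \<comment> \<open>\<open>V k\<close> preserves the orbit: it is W^(k-1) V_1, and pulling it
      through W^m turns the exponent into n m.\<close>
    have "V 1 y \<in> P" using imageI[OF y, of "V 1"] P by simp
    have "V k x = (W ^^ (n * m)) (V k y)" using k by (simp add: x W_power_mult_V)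
    also have "V k y = (W ^^ (k - 1)) (V 1 y)" using k W_power_V[of 1 "k - 1"] by simp
    also have "(W ^^ (n * m)) ((W ^^ (k - 1)) (V 1 y)) = (W ^^ (n * m + (k - 1))) (V 1 y)"
      by (simp add: funpow_add)
    finally show "V k x \<in> closed_csubspace hull S"
      using W_S[OF \<open>V 1 y \<in> P\<close>] by (simp add: hull_inc)
    show "adj (V k) x \<in> closed_csubspace hull S"
      unfolding xz row_isometry_adj[OF V_row k j]
      using W_S[OF z(1)] zero by (simp add: hull_inc)
  qed
  then show ?thesis by (simp add: S_def)
qed

lemma zero_mem_Inter_power:
  assumes "operator_on UNIV A" "0 \<in> M"
  shows "0 \<in> (\<Inter>m. (A ^^ m) ` M)"
proof
  fix m
  have "(A ^^ m) 0 = 0" by (induction m) (simp_all add: operator_zero[OF assms(1)])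
  then show "0 \<in> (A ^^ m) ` M" using assms(2) by (metis imageI)
qed

text \<open>The intersection for \<open>T\<close> is itself \<open>W_unitary\<close>; the one in
  \<open>V_defect M\<close> generates a \<open>W_unitary\<close> space by words in \<open>V\<close>;
  the one in \<open>W_defect M\<close> generates a \<open>V_unitary\<close> space by powers of
  \<open>W\<close>.\<close>

lemma weak_bishiftI:
  assumes M: "reducing M"
    and no_W: "\<And>N. W_unitary N \<Longrightarrow> N \<subseteq> M \<Longrightarrow> N \<subseteq> {0}"
    and no_V: "\<And>N. V_unitary N \<Longrightarrow> N \<subseteq> M \<Longrightarrow> N \<subseteq> {0}"
  shows "weak_bishift_on M n W V"
  unfolding weak_bishift_on_reducing[OF M]
proof (intro conjI equalityI)
  have one: "1 \<in> {1..n}" using n_pos by simp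
  note closed = reducing_closed[OF M]
  note zero = closed_csubspace_0[OF closed]
  have zero_W: "(W ^^ j) 0 = 0" for j
    by (induction j) (simp_all add: operator_zero[OF W_operator])
  have zero_V: "(V 1 ^^ j) 0 = 0" for j
    by (induction j) (simp_all add: operator_zero[OF V_operator[OF one], simplified])
  have "0 \<in> V_defect M"
    using zero operator_zero[OF adj_V_operator] by (simp add: V_defect_def zero_W)
  then show "{0} \<subseteq> (\<Inter>m. (W ^^ m) ` V_defect M)"
    using zero_mem_Inter_power[OF W_operator] by blast
  have "0 \<in> W_defect M"
    using zero operator_zero[OF adj_W_operator] by (simp add: W_defect_def zero_V del: One_nat_def)
  then show "{0} \<subseteq> (\<Inter>m. (V 1 ^^ m) ` W_defect M)"
    using zero_mem_Inter_power[OF V_operator[OF one]] by blast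
  have "0 \<in> (\<Inter>m. word_range M n T m)"
    using closed_csubspace_0[OF closed_csubspace_word_range[OF T_row closed]] by blast
  then show "{0} \<subseteq> (\<Inter>m. word_range M n T m)" by blast
  have "(\<Inter>m. word_range M n T m) \<subseteq> word_range M n T 0" by blast
  then show "(\<Inter>m. word_range M n T m) \<subseteq> {0}"
    using no_W[OF W_unitary_Inter_word_range_T[OF M]] by simp
  show "(\<Inter>m. (W ^^ m) ` V_defect M) \<subseteq> {0}"
  proof -
    define P where "P = (\<Inter>m. (W ^^ m) ` V_defect M)"
    have "P \<subseteq> (W ^^ 0) ` V_defect M" unfolding P_def by blast
    then have P_defect: "x \<in> V_defect M" if "x \<in> P" for x using that by auto
    have orbit: "V_orbit P \<subseteq> M"
    proof
      fix x assume "x \<in> V_orbit P"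
      then show "x \<in> M"
        by induction (use P_defect reducing_V[OF M] in \<open>auto simp: V_defect_def\<close>)
    qed
    have ker: "adj (V k) x = 0" if "k \<in> {1..n}" "x \<in> P" for k x
    proof -
      have "adj (V k) ((W ^^ 0) x) = 0"
        using that P_defect unfolding V_defect_def by blast
      then show ?thesis by simp
    qed
    have inv: "W ` P = P"
      unfolding P_def by (rule image_Inter_power[OF W_isometry W_V_defect[OF M]])
    have "W_unitary (closed_csubspace hull V_orbit P)"
      by (rule W_unitary_hull_V_orbit) (fact inv, fact ker)
    moreover have "closed_csubspace hull V_orbit P \<subseteq> M"
      using orbit closed by (rule hull_minimal)
    ultimately have "closed_csubspace hull V_orbit P \<subseteq> {0}" by (rule no_W)
    moreover have "P \<subseteq> closed_csubspace hull V_orbit P"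
      by (intro subsetI hull_inc V_orbit.base)
    ultimately show ?thesis unfolding P_def by blast
  qed
  show "(\<Inter>m. (V 1 ^^ m) ` W_defect M) \<subseteq> {0}"
  proof -
    define P where "P = (\<Inter>m. (V 1 ^^ m) ` W_defect M)"
    have "P \<subseteq> (V 1 ^^ 0) ` W_defect M" unfolding P_def by blast
    then have P_defect: "x \<in> W_defect M" if "x \<in> P" for x using that by auto
    have orbit: "(\<Union>m. (W ^^ m) ` P) \<subseteq> M"
      using P_defect reducing_W_power[OF M] by (auto simp: W_defect_def)
    have ker: "adj W x = 0" if "x \<in> P" for x
    proof -
      have "adj W ((V 1 ^^ 0) x) = 0"
        using P_defect[OF that] unfolding W_defect_def by blast
      then show ?thesis by simp
    qed
    have inv: "V 1 ` P = P"
      unfolding P_def by (rule image_Inter_power[OF V_isometry[OF one] V_W_defect[OF M]])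
    have "V_unitary (closed_csubspace hull (\<Union>m. (W ^^ m) ` P))"
      by (rule V_unitary_hull_W_orbit) (fact inv, fact ker)
    moreover have "closed_csubspace hull (\<Union>m. (W ^^ m) ` P) \<subseteq> M"
      using orbit closed by (rule hull_minimal)
    ultimately have "closed_csubspace hull (\<Union>m. (W ^^ m) ` P) \<subseteq> {0}" by (rule no_V)
    moreover have "(W ^^ 0) ` P \<subseteq> (\<Union>m. (W ^^ m) ` P)" by blast
    then have "P \<subseteq> closed_csubspace hull (\<Union>m. (W ^^ m) ` P)"
      using hull_subset[of "\<Union>m. (W ^^ m) ` P" closed_csubspace] by simp
    ultimately show ?thesis unfolding P_def by blast
  qed
qed

subsection \<open>The decomposition\<close>

text \<open>The conclusion of the theorem in terms of the predicates of this context;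
  \<open>wold_decomposition_iff\<close> is the translation.\<close>

definition wold_decomposition :: "'a set \<Rightarrow> 'a set \<Rightarrow> 'a set \<Rightarrow> 'a set \<Rightarrow> bool" where
  "wold_decomposition Huu Hus Hsu Hws \<longleftrightarrow>
    sorted_wrt orthogonal_sets [Huu, Hus, Hsu, Hws] \<and>
    (\<forall>x. \<exists>a\<in>Huu. \<exists>b\<in>Hus. \<exists>c\<in>Hsu. \<exists>d\<in>Hws. x = a + b + c + d) \<and>
    reducing Huu \<and> reducing Hus \<and> reducing Hsu \<and> reducing Hws \<and>
    W_unitary Huu \<and> V_unitary Huu \<and>
    W_unitary Hus \<and> (\<Inter>m. word_range Hus n V m) = {0} \<and>
    (\<Inter>m. (W ^^ m) ` Hsu) = {0} \<and> V_unitary Hsu \<and>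
    weak_bishift_on Hws n W V"

lemma unitary_on_iff: "reducing M \<Longrightarrow> unitary_on M W \<longleftrightarrow> W_unitary M"
  by (simp add: unitary_on_reducing[OF W_isometry] reducing_iff W_unitary_def)

lemma row_unitary_on_iff: "reducing M \<Longrightarrow> row_unitary_on M n V \<longleftrightarrow> V_unitary M"
  using row_unitary_on_reducing[OF V_row, of M] by (auto simp: reducing_iff V_unitary_def)

lemma pure_isometry_on_iff:
  "reducing M \<Longrightarrow> pure_isometry_on M W \<longleftrightarrow> (\<Inter>m. (W ^^ m) ` M) = {0}"
  using isometry_on_invariant[OF W_isometry, of M]
  by (auto simp: pure_isometry_on_def dest: reducing_W)

lemma pure_row_isometry_on_iff:
  "reducing M \<Longrightarrow> pure_row_isometry_on M n V \<longleftrightarrow> (\<Inter>m. word_range M n V m) = {0}"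
proof -
  assume M: "reducing M"
  have "row_isometry_on M n V"
    using reducing_V[OF M] by (intro row_isometry_on_invariant[OF V_row]) blast
  then show ?thesis by (simp add: pure_row_isometry_on_def)
qed

lemma wold_decomposition_iff:
  "wold_decomposition Huu Hus Hsu Hws \<longleftrightarrow>
    sorted_wrt orthogonal_sets [Huu, Hus, Hsu, Hws] \<and>
    (\<forall>x. \<exists>a\<in>Huu. \<exists>b\<in>Hus. \<exists>c\<in>Hsu. \<exists>d\<in>Hws. x = a + b + c + d) \<and>
    (\<forall>M\<in>{Huu, Hus, Hsu, Hws}. reduces M W \<and> (\<forall>i\<in>{1..n}. reduces M (V i))) \<and>
    unitary_on Huu W \<and> row_unitary_on Huu n V \<and>
    unitary_on Hus W \<and> pure_row_isometry_on Hus n V \<and>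
    pure_isometry_on Hsu W \<and> row_unitary_on Hsu n V \<and>
    weak_bishift_on Hws n W V"
proof -
  have "(\<forall>M\<in>{Huu, Hus, Hsu, Hws}. reduces M W \<and> (\<forall>i\<in>{1..n}. reduces M (V i)))
      \<longleftrightarrow> reducing Huu \<and> reducing Hus \<and> reducing Hsu \<and> reducing Hws"
    by (simp add: reducing_iff)
  then show ?thesis
    by (simp only: wold_decomposition_def unitary_on_iff row_unitary_on_iff
        pure_isometry_on_iff pure_row_isometry_on_iff conj_assoc cong: conj_cong)
qed

lemma wold_decomposition_exists:
  defines "Huu \<equiv> max_W_unitary \<inter> max_V_unitary"
  shows "wold_decomposition Huu (max_W_unitary \<inter> orthogonal_complement Huu)
    (max_V_unitary \<inter> orthogonal_complement Huu)
    (orthogonal_complement max_W_unitary \<inter> orthogonal_complement max_V_unitary)"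
proof -
  define Hus where "Hus = max_W_unitary \<inter> orthogonal_complement Huu"
  define Hsu where "Hsu = max_V_unitary \<inter> orthogonal_complement Huu"
  define Hws where "Hws = orthogonal_complement max_W_unitary \<inter> orthogonal_complement max_V_unitary"
  have maxW: "reducing max_W_unitary" and maxV: "reducing max_V_unitary"
    using W_unitary_max V_unitary_max by (auto simp: W_unitary_def V_unitary_def)
  have uu: "reducing Huu"
    unfolding Huu_def by (rule reducing_Int[OF maxW maxV])
  have us: "reducing Hus" and su: "reducing Hsu" and ws: "reducing Hws"
    unfolding Hus_def Hsu_def Hws_def
    by (rule reducing_Int maxW maxV uu reducing_orthogonal_complement)+
  have W_uu: "W_unitary Huu" and V_uu: "V_unitary Huu"
    and W_us: "W_unitary Hus" and V_su: "V_unitary Hsu"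
    using W_unitary_subset[OF W_unitary_max uu] V_unitary_subset[OF V_unitary_max uu]
      W_unitary_subset[OF W_unitary_max us] V_unitary_subset[OF V_unitary_max su]
    by (auto simp: Huu_def Hus_def Hsu_def)
  have disjoint: "x = 0" if "x \<in> max_W_unitary" "x \<in> max_V_unitary" "x \<in> orthogonal_complement Huu" for x
    using that orthogonal_complement_Int[OF reducing_closed[OF uu]] by (simp add: Huu_def)
  have pure_us: "(\<Inter>m. word_range Hus n V m) = {0}"
  proof (rule subset_antisym)
    have "V_unitary (\<Inter>m. word_range Hus n V m)" by (rule V_unitary_Inter_word_range_V[OF W_us])
    then have "(\<Inter>m. word_range Hus n V m) \<subseteq> max_V_unitary" by (rule V_unitary_le_max)
    moreover have "(\<Inter>m. word_range Hus n V m) \<subseteq> word_range Hus n V 0" by blast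
    ultimately have "(\<Inter>m. word_range Hus n V m) \<subseteq> max_V_unitary \<inter> Hus" by simp
    also have "\<dots> \<subseteq> {0}" using disjoint by (auto simp: Hus_def)
    finally show "(\<Inter>m. word_range Hus n V m) \<subseteq> {0}" .
    show "{0} \<subseteq> (\<Inter>m. word_range Hus n V m)"
      using closed_csubspace_0[OF closed_csubspace_word_range[OF V_row reducing_closed[OF us]]] by blast
  qed
  have pure_su: "(\<Inter>m. (W ^^ m) ` Hsu) = {0}"
  proof (rule subset_antisym)
    have "W_unitary (\<Inter>m. (W ^^ m) ` Hsu)" by (rule W_unitary_Inter_power[OF V_su])
    then have "(\<Inter>m. (W ^^ m) ` Hsu) \<subseteq> max_W_unitary" by (rule W_unitary_le_max)
    moreover have "(\<Inter>m. (W ^^ m) ` Hsu) \<subseteq> (W ^^ 0) ` Hsu" by blast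
    ultimately have "(\<Inter>m. (W ^^ m) ` Hsu) \<subseteq> max_W_unitary \<inter> Hsu" by simp
    also have "\<dots> \<subseteq> {0}" using disjoint by (auto simp: Hsu_def)
    finally show "(\<Inter>m. (W ^^ m) ` Hsu) \<subseteq> {0}" .
    show "{0} \<subseteq> (\<Inter>m. (W ^^ m) ` Hsu)"
      using zero_mem_Inter_power[OF W_operator closed_csubspace_0[OF reducing_closed[OF su]]] by blast
  qed
  have bishift: "weak_bishift_on Hws n W V"
  proof (rule weak_bishiftI[OF ws])
    fix N assume "W_unitary N" "N \<subseteq> Hws"
    then show "N \<subseteq> {0}"
      using W_unitary_le_max[of N] orthogonal_complement_Int[OF reducing_closed[OF maxW]]
      by (auto simp: Hws_def)
  next
    fix N assume "V_unitary N" "N \<subseteq> Hws"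
    then show "N \<subseteq> {0}"
      using V_unitary_le_max[of N] orthogonal_complement_Int[OF reducing_closed[OF maxV]]
      by (auto simp: Hws_def)
  qed
  \<comment> \<open>\<open>Hus\<close> and \<open>Hsu\<close> are complements of \<open>Huu\<close>
    in two different spaces, so their orthogonality is not visible from the construction; it comes
    from \<open>W\<close> being unitary on one and pure on the other.\<close>
  have orth: "orthogonal_sets Hus Hsu"
    unfolding orthogonal_sets_iff by (rule W_unitary_orthogonal_pure[OF W_us su pure_su])
  have "orthogonal_sets Hus Huu" "orthogonal_sets Hsu Huu" "orthogonal_sets Hws Huu"
      "orthogonal_sets Hws Hus" "orthogonal_sets Hws Hsu"
    by (auto simp: orthogonal_sets_def orthogonal_complement_def Huu_def Hus_def Hsu_def Hws_def)
  then have sorted: "sorted_wrt orthogonal_sets [Huu, Hus, Hsu, Hws]"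
    using orth by (simp add: orthogonal_sets_commute)
  have span: "\<exists>a\<in>Huu. \<exists>b\<in>Hus. \<exists>c\<in>Hsu. \<exists>d\<in>Hws. x = a + b + c + d" for x
  proof -
    obtain a where a: "a \<in> Huu" "x - a \<in> orthogonal_complement Huu"
      using orthogonal_decomposition[OF reducing_closed[OF uu]] .
    obtain b where b: "b \<in> Hus" "x - a - b \<in> orthogonal_complement Hus"
      using orthogonal_decomposition[OF reducing_closed[OF us]] .
    obtain c where c: "c \<in> Hsu" "x - a - b - c \<in> orthogonal_complement Hsu"
      using orthogonal_decomposition[OF reducing_closed[OF su]] .
    define d where "d = x - a - b - c"
    note diff = closed_csubspace_diff[OF closed_csubspace_orthogonal_complement]
    have d_uu: "d \<in> orthogonal_complement Huu"
      using diff[OF diff[OF a(2), of b], of c] b(1) c(1) by (simp add: d_def Hus_def Hsu_def)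
    have d_us: "d \<in> orthogonal_complement Hus"
      using diff[OF b(2), of c] c(1) iffD1[OF orthogonal_sets_commute orth]
      by (auto simp: d_def orthogonal_sets_iff)
    have d_su: "d \<in> orthogonal_complement Hsu" using c by (simp add: d_def)
    \<comment> \<open>\<open>Huu\<close> and \<open>K \<inter> orthogonal_complement Huu\<close>
      together span \<open>K\<close>, and \<open>d\<close> is orthogonal to both. The two maximal
      spaces serve as \<open>K\<close>.\<close>
    have split: "cinner d y = 0"
      if y: "y \<in> K" and K: "reducing K" "Huu \<subseteq> K"
        and d: "d \<in> orthogonal_complement (K \<inter> orthogonal_complement Huu)" for y K
    proof -
      obtain p where p: "p \<in> Huu" "y - p \<in> orthogonal_complement Huu"
        using orthogonal_decomposition[OF reducing_closed[OF uu]] .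
      have "y - p \<in> K" using closed_csubspace_diff[OF reducing_closed[OF K(1)] y] p K(2) by blast
      then have "cinner d (y - p) = 0" using p d by (simp add: orthogonal_complement_def)
      moreover have "cinner d p = 0" using p d_uu by (simp add: orthogonal_complement_def)
      ultimately show ?thesis by (simp add: cinner_diff_right)
    qed
    have "d \<in> Hws"
      using split[OF _ maxW _ d_us[unfolded Hus_def]] split[OF _ maxV _ d_su[unfolded Hsu_def]]
      unfolding Hws_def orthogonal_complement_def[of max_W_unitary]
        orthogonal_complement_def[of max_V_unitary] by (simp add: Huu_def)
    moreover have "x = a + b + c + d" by (simp add: d_def)
    ultimately show ?thesis using a b c by blast
  qed
  show ?thesis
    unfolding wold_decomposition_def Hus_def[symmetric] Hsu_def[symmetric] Hws_def[symmetric]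
    by (intro conjI allI sorted span uu us su ws W_uu V_uu W_us V_su pure_us pure_su bishift)
qed

text \<open>A vector of \<open>max_W_unitary\<close> has no component in \<open>Hsu\<close>, where
  \<open>W\<close> is pure; its component in \<open>Hws\<close> then lies in
  \<open>max_W_unitary\<close> too and vanishes, a weak bi-shift having no \<open>W\<close>-unitary
  part. So \<open>max_W_unitary\<close> is \<open>Huu + Hus\<close>, and symmetrically
  \<open>max_V_unitary\<close> is \<open>Huu + Hsu\<close>; the four identities follow.\<close>

lemma wold_decomposition_unique:
  assumes D: "wold_decomposition Huu Hus Hsu Hws"
  shows "Huu = max_W_unitary \<inter> max_V_unitary"
    and "Hus = max_W_unitary \<inter> orthogonal_complement (max_W_unitary \<inter> max_V_unitary)"
    and "Hsu = max_V_unitary \<inter> orthogonal_complement (max_W_unitary \<inter> max_V_unitary)"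
    and "Hws = orthogonal_complement max_W_unitary \<inter> orthogonal_complement max_V_unitary"
proof -
  have red: "reducing Huu" "reducing Hus" "reducing Hsu" "reducing Hws"
    and unitary: "W_unitary Huu" "V_unitary Huu" "W_unitary Hus" "V_unitary Hsu"
    and pure: "(\<Inter>m. word_range Hus n V m) = {0}" "(\<Inter>m. (W ^^ m) ` Hsu) = {0}"
    and bishift: "weak_bishift_on Hws n W V"
    using D by (simp_all add: wold_decomposition_def)
  have span: "\<exists>a\<in>Huu. \<exists>b\<in>Hus. \<exists>c\<in>Hsu. \<exists>d\<in>Hws. x = a + b + c + d" for x
    using D by (simp add: wold_decomposition_def)
  have orth: "cinner a b = 0" "cinner a c = 0" "cinner a d = 0" "cinner b c = 0" "cinner b d = 0"
    "cinner c d = 0" "cinner b a = 0" "cinner c a = 0" "cinner d a = 0" "cinner c b = 0"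
    "cinner d b = 0" "cinner d c = 0"
    if "a \<in> Huu" "b \<in> Hus" "c \<in> Hsu" "d \<in> Hws" for a b c d
    using D that
    by (auto simp: wold_decomposition_def orthogonal_sets_def cinner_eq_0_commute)
  have sub: "Huu \<subseteq> max_W_unitary" "Huu \<subseteq> max_V_unitary" "Hus \<subseteq> max_W_unitary" "Hsu \<subseteq> max_V_unitary"
    using unitary W_unitary_le_max V_unitary_le_max by blast+
  have maxW: "reducing max_W_unitary" and maxV: "reducing max_V_unitary"
    using W_unitary_max V_unitary_max by (auto simp: W_unitary_def V_unitary_def)
  note diffW = closed_csubspace_diff[OF reducing_closed[OF maxW]]
    and diffV = closed_csubspace_diff[OF reducing_closed[OF maxV]]
  \<comment> \<open>\<open>orth\<close> speaks of four vectors at once; zero vectors fill the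
    remaining places when only two matter.\<close>
  have zero: "0 \<in> Huu" "0 \<in> Hus" "0 \<in> Hsu" "0 \<in> Hws"
    using red by (simp_all add: closed_csubspace_0 reducing_closed)
  have noW: "x = 0" if "x \<in> max_W_unitary" "x \<in> Hws" for x
    using weak_bishift_W_unitary[OF red(4) bishift, of "max_W_unitary \<inter> Hws"]
      W_unitary_subset[OF W_unitary_max reducing_Int[OF maxW red(4)]] that by blast
  have noV: "x = 0" if "x \<in> max_V_unitary" "x \<in> Hws" for x
    using weak_bishift_V_unitary[OF red(4) bishift, of "max_V_unitary \<inter> Hws"]
      V_unitary_subset[OF V_unitary_max reducing_Int[OF maxV red(4)]] that by blast
  have splitW: "\<exists>a\<in>Huu. \<exists>b\<in>Hus. x = a + b" if x: "x \<in> max_W_unitary" for x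
  proof -
    obtain a b c d where abcd: "a \<in> Huu" "b \<in> Hus" "c \<in> Hsu" "d \<in> Hws" and eq: "x = a + b + c + d"
      using span by blast
    have "cinner x c = 0"
      using W_unitary_orthogonal_pure[OF W_unitary_max red(3) pure(2)] x abcd(3)
      by (auto simp: orthogonal_complement_def)
    \<comment> \<open>Pairing with \<open>c\<close> isolates it:
      \<open>cinner x c = cinner c c\<close>.\<close>
    then have "c = 0" using orth[OF abcd] by (simp add: eq cinner_add_left)
    moreover have "d = 0"
    proof (rule noW[OF _ abcd(4)])
      have "d = x - a - b" by (simp add: eq \<open>c = 0\<close>)
      then show "d \<in> max_W_unitary" using x abcd sub by (auto intro!: diffW)
    qed
    ultimately show ?thesis using abcd eq by auto
  qed
  have splitV: "\<exists>a\<in>Huu. \<exists>c\<in>Hsu. x = a + c" if x: "x \<in> max_V_unitary" for x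
  proof -
    obtain a b c d where abcd: "a \<in> Huu" "b \<in> Hus" "c \<in> Hsu" "d \<in> Hws" and eq: "x = a + b + c + d"
      using span by blast
    have "cinner x b = 0"
      using V_unitary_orthogonal_pure[OF V_unitary_max red(2) pure(1)] x abcd(2)
      by (auto simp: orthogonal_complement_def)
    then have "b = 0" using orth[OF abcd] by (simp add: eq cinner_add_left)
    moreover have "d = 0"
    proof (rule noV[OF _ abcd(4)])
      have "d = x - a - c" by (simp add: eq \<open>b = 0\<close>)
      then show "d \<in> max_V_unitary" using x abcd sub by (auto intro!: diffV)
    qed
    ultimately show ?thesis using abcd eq by auto
  qed
  show uu: "Huu = max_W_unitary \<inter> max_V_unitary"
  proof (intro equalityI subsetI)
    fix x assume x: "x \<in> max_W_unitary \<inter> max_V_unitary"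
    then obtain a b where ab: "a \<in> Huu" "b \<in> Hus" and eq: "x = a + b" using splitW by blast
    have "cinner x b = 0"
      using V_unitary_orthogonal_pure[OF V_unitary_max red(2) pure(1)] x ab(2)
      by (auto simp: orthogonal_complement_def)
    then have "b = 0" using orth(1)[OF ab zero(3,4)] by (simp add: eq cinner_add_left)
    then show "x \<in> Huu" using ab eq by simp
  qed (use sub in blast)
  show "Hus = max_W_unitary \<inter> orthogonal_complement (max_W_unitary \<inter> max_V_unitary)"
    unfolding uu[symmetric]
  proof (intro equalityI subsetI)
    fix x assume "x \<in> Hus"
    then show "x \<in> max_W_unitary \<inter> orthogonal_complement Huu"
      using sub orth(7)[OF _ _ zero(3,4)] by (auto simp: orthogonal_complement_def)
  next
    fix x assume x: "x \<in> max_W_unitary \<inter> orthogonal_complement Huu"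
    then obtain a b where ab: "a \<in> Huu" "b \<in> Hus" and eq: "x = a + b" using splitW by blast
    have "cinner x a = 0" using x ab by (simp add: orthogonal_complement_def)
    then have "a = 0" using orth(7)[OF ab zero(3,4)] by (simp add: eq cinner_add_left)
    then show "x \<in> Hus" using ab eq by simp
  qed
  show "Hsu = max_V_unitary \<inter> orthogonal_complement (max_W_unitary \<inter> max_V_unitary)"
    unfolding uu[symmetric]
  proof (intro equalityI subsetI)
    fix x assume "x \<in> Hsu"
    then show "x \<in> max_V_unitary \<inter> orthogonal_complement Huu"
      using sub orth(8)[OF _ zero(2) _ zero(4)] by (auto simp: orthogonal_complement_def)
  next
    fix x assume x: "x \<in> max_V_unitary \<inter> orthogonal_complement Huu"
    then obtain a c where ac: "a \<in> Huu" "c \<in> Hsu" and eq: "x = a + c" using splitV by blast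
    have "cinner x a = 0" using x ac by (simp add: orthogonal_complement_def)
    then have "a = 0" using orth(8)[OF ac(1) zero(2) ac(2) zero(4)] by (simp add: eq cinner_add_left)
    then show "x \<in> Hsu" using ac eq by simp
  qed
  show "Hws = orthogonal_complement max_W_unitary \<inter> orthogonal_complement max_V_unitary"
  proof (intro equalityI subsetI)
    fix x assume x: "x \<in> Hws"
    have "cinner x y = 0" if "y \<in> max_W_unitary" for y
      using splitW[OF that] orth(9)[OF _ zero(2,3) x] orth(11)[OF zero(1) _ zero(3) x]
      by (auto simp: cinner_add_right)
    moreover have "cinner x y = 0" if "y \<in> max_V_unitary" for y
      using splitV[OF that] orth(9)[OF _ zero(2,3) x] orth(12)[OF zero(1,2) _ x]
      by (auto simp: cinner_add_right)
    ultimately show "x \<in> orthogonal_complement max_W_unitary \<inter> orthogonal_complement max_V_unitary"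
      by (simp add: orthogonal_complement_def)
  next
    fix x assume x: "x \<in> orthogonal_complement max_W_unitary \<inter> orthogonal_complement max_V_unitary"
    obtain a b c d where abcd: "a \<in> Huu" "b \<in> Hus" "c \<in> Hsu" "d \<in> Hws" and eq: "x = a + b + c + d"
      using span by blast
    have "cinner x a = 0" "cinner x b = 0" "cinner x c = 0"
      using x abcd sub by (auto simp: orthogonal_complement_def)
    then have "a = 0" "b = 0" "c = 0"
      using orth[OF abcd] by (simp_all add: eq cinner_add_left)
    then show "x \<in> Hws" using abcd eq by simp
  qed
qed

end

theorem theorem3p10:
  fixes n :: nat
    and W :: "'a::complex_hilbert_space \<Rightarrow> 'a"
    and V :: "nat \<Rightarrow> 'a \<Rightarrow> 'a"
  assumes "n \<ge> 1"
    and "odometer_rep_on UNIV n W V"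
  shows "\<exists>!D. case D of (Huu, Hus, Hsu, Hws) \<Rightarrow>
    sorted_wrt orthogonal_sets [Huu, Hus, Hsu, Hws] \<and>
    (\<forall>x. \<exists>a\<in>Huu. \<exists>b\<in>Hus. \<exists>c\<in>Hsu. \<exists>d\<in>Hws. x = a + b + c + d) \<and>
    (\<forall>M\<in>{Huu, Hus, Hsu, Hws}. reduces M W \<and> (\<forall>i\<in>{1..n}. reduces M (V i))) \<and>
    unitary_on Huu W \<and> row_unitary_on Huu n V \<and>
    unitary_on Hus W \<and> pure_row_isometry_on Hus n V \<and>
    pure_isometry_on Hsu W \<and> row_unitary_on Hsu n V \<and>
    weak_bishift_on Hws n W V"
proof -
  interpret odometer_rep n W V by unfold_locales (rule assms)+
  show ?thesis
    unfolding wold_decomposition_iff[symmetric]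
  proof (rule ex1I)
    show "case (max_W_unitary \<inter> max_V_unitary,
        max_W_unitary \<inter> orthogonal_complement (max_W_unitary \<inter> max_V_unitary),
        max_V_unitary \<inter> orthogonal_complement (max_W_unitary \<inter> max_V_unitary),
        orthogonal_complement max_W_unitary \<inter> orthogonal_complement max_V_unitary) of
      (Huu, Hus, Hsu, Hws) \<Rightarrow> wold_decomposition Huu Hus Hsu Hws"
      using wold_decomposition_exists by simp
  next
    fix D :: "'a set \<times> 'a set \<times> 'a set \<times> 'a set"
    assume "case D of (Huu, Hus, Hsu, Hws) \<Rightarrow> wold_decomposition Huu Hus Hsu Hws"
    then show "D = (max_W_unitary \<inter> max_V_unitary,
        max_W_unitary \<inter> orthogonal_complement (max_W_unitary \<inter> max_V_unitary),
        max_V_unitary \<inter> orthogonal_complement (max_W_unitary \<inter> max_V_unitary),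
        orthogonal_complement max_W_unitary \<inter> orthogonal_complement max_V_unitary)"
      by (auto dest: wold_decomposition_unique split: prod.splits)
  qed
qed

end
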